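(* Let $H$ be a subgroup of $PL_o(I)$. Then $H$ is non-solvable if and only if $H$ contains a subgroup isomorphic to $W=\bigoplus_{i\in\mathbf{N}}W_i$.
   Context: $PL_o(I)$ is the group of orientation-preserving piecewise-linear homeomorphisms of $I=[0,1]$ with finitely many breaks in slope. For a group $A$, $A\wr\mathbf{Z}=(\bigoplus_{i\in\mathbf{Z}}A)\rtimes\mathbf{Z}$ is the restricted wreath product with $\mathbf{Z}$ acting by index shift. $\mathbf{N}$ is the set of positive integers. Define $W_0$ to be the trivial group and $W_i=W_{i-1}\wr\mathbf{Z}$ for $i\in\mathbf{N}$, so $W_i=(\cdots((\mathbf{Z}\wr\mathbf{Z})\wr\mathbf{Z})\cdots)\wr\mathbf{Z}$ with $i$ copies of $\mathbf{Z}$. *)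

theory Defs
  imports "HOL-Analysis.Analysis" "HOL-Algebra.Solvable_Groups" "HOL-Algebra.Product_Groups"
begin

text \<open>A map f : real => real represents an element of PL_o([0,1]) when it is an
  orientation-preserving (strictly increasing) homeomorphism of [0,1] onto itself which is
  piecewise linear with finitely many breaks: there is a finite subdivision
  0 = x_0 < x_1 < ... < x_n = 1 with f affine on each [x_j, x_(j+1)].
  Outside [0,1] we normalise f to be the identity, so that equality of functions
  coincides with equality of homeomorphisms of [0,1].\<close>

definition PL_piecewise_linear :: "(real \<Rightarrow> real) \<Rightarrow> bool" where
  "PL_piecewise_linear f \<longleftrightarrow>
     (\<exists>xs :: real list. length xs \<ge> 2 \<and> sorted_wrt (<) xs \<and> hd xs = 0 \<and> last xs = 1 \<and>
        (\<forall>j. Suc j < length xs \<longrightarrow>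
           (\<exists>a b. \<forall>x\<in>{xs ! j .. xs ! Suc j}. f x = a * x + b)))"

definition PLo_set :: "(real \<Rightarrow> real) set" where
  "PLo_set = {f. (\<exists>g. homeomorphism {0..1} {0..1} f g) \<and> strict_mono_on {0..1} f
                 \<and> PL_piecewise_linear f \<and> (\<forall>x. x \<notin> {0..1} \<longrightarrow> f x = x)}"

definition PLo :: "(real \<Rightarrow> real) monoid" where
  "PLo = \<lparr>carrier = PLo_set, monoid.mult = (\<circ>), one = id\<rparr>"

text \<open>A universe of elements: Triv is the element of the trivial group W_0, and
  Wr f n is the element (f, n) of A wr Z, with f : Z -> A finitely supported.\<close>

datatype wel = Triv | Wr (wfun: "int \<Rightarrow> wel") (wint: int)

text \<open>Restricted wreath product A wr Z = (bigoplus_Z A) semidirect Z, with Z acting by shift: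
  (f, m)(g, n) = (f * (g shifted by m), m + n), where (g shifted by m)(k) = g(k - m).\<close>

definition wreathZ :: "wel monoid \<Rightarrow> wel monoid" where
  "wreathZ A = \<lparr>carrier = {Wr f n | f n. (\<forall>k. f k \<in> carrier A) \<and> finite {k. f k \<noteq> \<one>\<^bsub>A\<^esub>}},
                monoid.mult = (\<lambda>x y. Wr (\<lambda>k. wfun x k \<otimes>\<^bsub>A\<^esub> wfun y (k - wint x)) (wint x + wint y)),
                one = Wr (\<lambda>_. \<one>\<^bsub>A\<^esub>) 0\<rparr>"

primrec Wgrp :: "nat \<Rightarrow> wel monoid" where
  "Wgrp 0 = \<lparr>carrier = {Triv}, monoid.mult = (\<lambda>_ _. Triv), one = Triv\<rparr>"
| "Wgrp (Suc i) = wreathZ (Wgrp i)"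

definition Wsum :: "(nat \<Rightarrow> wel) monoid" where
  "Wsum = sum_group {i. 1 \<le> i} Wgrp"

end

theory Submission
  imports Defs
begin

text \<open>Elements of the derived subgroup \<open>G'\<close> of \<open>G \<le> PL\<^sub>o(I)\<close> have slope 1 on both sides of every common
  fixed point of \<open>G\<close>, so the closed support of a finite subset of \<open>G'\<close> avoids these points and is
  covered by finitely many compact intervals free of them.  Some \<open>h \<in> G\<close> displaces all these
  intervals at once, whence a subgroup \<open>K\<close> of \<open>G'\<close> with support there generates \<open>K \<wr> \<int>\<close> together
  with \<open>h\<close>.  As \<open>G'\<close> is non-solvable with \<open>G\<close>, induction embeds every \<open>W\<^sub>n\<close> into every
  non-solvable \<open>G\<close>, with the support controlled by finitely many elements.  Applying this to \<open>G'\<close>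
  and conjugating successive copies by displacing elements makes their supports pairwise disjoint,
  which gives the direct sum.  Conversely \<open>W\<^sub>n\<close> has derived length at least \<open>n\<close>.\<close>

text \<open>Common fixed points cut [0,1] into pieces that G preserves. Within one piece
  displacement is easy, since the supremum of an orbit is a common fixed point. The obstacle is that
  the covering intervals may lie in different pieces, where an element that moves one of them far
  may leave another in place. So a displacing element for finitely many intervals is combined with
  one for a further interval, with exponents chosen one after the other. The derived subgroup is
  needed because an element with slope other than 1 at a common fixed point moves a whole one-sided
  neighbourhood of it, and no element of G throws such a support off itself. Each wreath product
  thus costs one derived subgroup, and non-solvability is what keeps the chain from running out.
  Compactness arguments need finitely many elements, so the induction records, beside each
  embedding, a finite set whose supports cover the support of the image.\<close>

section \<open>The group of piecewise linear homeomorphisms\<close>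

text \<open>A set that merely has to contain the interior breaks replaces the ordered list:
  composition and inversion then need only unions, preimages and images, and no merging of
  lists.\<close>

definition breaks :: "(real \<Rightarrow> real) \<Rightarrow> real set \<Rightarrow> bool" where
  "breaks f S \<longleftrightarrow> finite S \<and> (\<forall>x y. 0 \<le> x \<and> x < y \<and> y \<le> 1 \<and> {x<..<y} \<inter> S = {} \<longrightarrow>
        (\<exists>a b. \<forall>z\<in>{x..y}. f z = a * z + b))"

lemma PL_piecewise_linear_iff:
  "PL_piecewise_linear f \<longleftrightarrow> (\<exists>S. breaks f S)" (is "_ \<longleftrightarrow> ?R")
proof
  assume "PL_piecewise_linear f"
  then obtain xs :: "real list" where len: "length xs \<ge> 2" and srt: "sorted_wrt (<) xs"
    and hd: "hd xs = 0" and last: "last xs = 1"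
    and aff: "\<And>j. Suc j < length xs \<Longrightarrow> \<exists>a b. \<forall>x\<in>{xs ! j .. xs ! Suc j}. f x = a * x + b"
    unfolding PL_piecewise_linear_def by blast
  have ne: "xs \<noteq> []" using len by auto
  have "\<exists>a b. \<forall>z\<in>{x..y}. f z = a * z + b"
    if h: "0 \<le> x" "x < y" "y \<le> 1" "{x<..<y} \<inter> set xs = {}" for x y
  proof -
    \<comment> \<open>The last subdivision point not above \<open>x\<close>; as no subdivision point
      lies strictly between \<open>x\<close> and \<open>y\<close>, its successor is not below
      \<open>y\<close>.\<close>
    define j where "j = Max {i. i < length xs \<and> xs ! i \<le> x}"
    have fin: "finite {i. i < length xs \<and> xs ! i \<le> x}" by simp
    have "0 \<in> {i. i < length xs \<and> xs ! i \<le> x}" using ne hd h(1) by (simp add: hd_conv_nth)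
    then have j: "j < length xs" "xs ! j \<le> x"
      using Max_in[OF fin] unfolding j_def by blast+
    have "j \<noteq> length xs - 1"
      using j(2) last ne h by (auto simp: last_conv_nth)
    with j(1) have sj: "Suc j < length xs" by simp
    have "\<not> xs ! Suc j \<le> x"
    proof
      assume "xs ! Suc j \<le> x"
      then have "Suc j \<le> j" using Max_ge[OF fin, of "Suc j"] sj unfolding j_def by simp
      then show False by simp
    qed
    moreover have "xs ! Suc j \<notin> {x<..<y}" using h(4) nth_mem[OF sj] by blast
    ultimately have "y \<le> xs ! Suc j" by auto
    then have "{x..y} \<subseteq> {xs ! j..xs ! Suc j}" using j(2) by auto
    then show ?thesis using aff[OF sj] by blast
  qed
  then show ?R unfolding breaks_def by (intro exI[of _ "set xs"]) auto
next
  assume ?R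
  then obtain S where fin: "finite S" and aff: "\<And>x y. \<lbrakk>0 \<le> x; x < y; y \<le> 1; {x<..<y} \<inter> S = {}\<rbrakk>
      \<Longrightarrow> \<exists>a b. \<forall>z\<in>{x..y}. f z = a * z + b" unfolding breaks_def by blast
  define T where "T = insert 0 (insert 1 (S \<inter> {0..1}))"
  define xs where "xs = sorted_list_of_set T"
  have finT: "finite T" using fin by (simp add: T_def)
  have set: "set xs = T" using finT by (simp add: xs_def)
  have srt: "sorted_wrt (<) xs" by (simp add: xs_def)
  have "card {0, 1::real} \<le> card T" by (rule card_mono[OF finT]) (auto simp: T_def)
  then have len: "length xs \<ge> 2" by (simp add: xs_def)
  then have ne: "xs \<noteq> []" by auto
  have mono: "xs ! i < xs ! j" if "i < j" "j < length xs" for i j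
    using srt that by (simp add: sorted_wrt_iff_nth_less)
  have range: "0 \<le> xs ! i" "xs ! i \<le> 1" if "i < length xs" for i
    using nth_mem[OF that] set by (auto simp: T_def)
  have "0 \<in> set xs" "1 \<in> set xs" using set by (auto simp: T_def)
  then obtain i k where i: "i < length xs" "xs ! i = 0" and k: "k < length xs" "xs ! k = 1"
    by (metis in_set_conv_nth)
  have "i = 0" using mono[of 0 i] i range(1)[of 0] ne by (cases i) force+
  then have hd: "hd xs = 0" using i ne by (simp add: hd_conv_nth)
  have "k = length xs - 1"
    using mono[of k "length xs - 1"] k range(2)[of "length xs - 1"] ne
    by (metis One_nat_def Suc_pred diff_less length_greater_0_conv less_Suc_eq not_le zero_less_one)
  then have last: "last xs = 1" using k ne by (simp add: last_conv_nth)
  have "\<exists>a b. \<forall>x\<in>{xs ! j .. xs ! Suc j}. f x = a * x + b" if j: "Suc j < length xs" for j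
  proof (rule aff)
    show "{xs ! j<..<xs ! Suc j} \<inter> S = {}"
    proof (rule ccontr)
      assume "{xs ! j<..<xs ! Suc j} \<inter> S \<noteq> {}"
      then obtain s where s: "s \<in> S" "xs ! j < s" "s < xs ! Suc j" by auto
      then have "s \<in> set xs" using range[of j] range[of "Suc j"] j set by (auto simp: T_def)
      then obtain l where l: "l < length xs" "xs ! l = s" by (metis in_set_conv_nth)
      have "l \<noteq> j" "l \<noteq> Suc j" using s l by auto
      then have "l < j \<or> Suc j < l" by linarith
      then show False using mono[of l j] mono[of "Suc j" l] l s j by auto
    qed
  qed (use range mono j in auto)
  then show "PL_piecewise_linear f"
    unfolding PL_piecewise_linear_def using len srt hd last by blast
qed

text \<open>A jump of a monotone function would leave a gap in its range.\<close>

lemma strict_mono_surj_continuous_on: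
  fixes f :: "real \<Rightarrow> real"
  assumes "strict_mono f" "surj f"
  shows "continuous_on UNIV f"
  using assms by (intro continuous_onI_mono) (auto simp: strict_mono_less_eq)

text \<open>An increasing map of [0,1] onto itself fixes the end points, so its extension by the
  identity is an order automorphism of the whole line. Later order arguments therefore need no
  membership in [0,1].\<close>

lemma PLo_set_iff:
  "f \<in> PLo_set \<longleftrightarrow> strict_mono f \<and> surj f \<and> (\<forall>x. x \<notin> {0<..<1} \<longrightarrow> f x = x) \<and> (\<exists>S. breaks f S)"
proof
  assume "f \<in> PLo_set"
  then obtain g where hom: "homeomorphism {0..1} {0..1} f g" and sm: "strict_mono_on {0..1} f"
    and pl: "PL_piecewise_linear f" and out: "\<And>x. x \<notin> {0..1} \<Longrightarrow> f x = x"
    unfolding PLo_set_def by blast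
  have im: "f ` {0..1} = {0..1}" using hom by (simp add: homeomorphism_def)
  have le: "f x \<le> f y \<longleftrightarrow> x \<le> y" if "x \<in> {0..1}" "y \<in> {0..1}" for x y
    using sm that by (rule strict_mono_on_less_eq)
  have f0: "f 0 = 0"
  proof -
    have "0 \<in> f ` {0..1}" using im by auto
    then obtain x where x: "x \<in> {0..1}" "f x = 0" by auto
    then have "f 0 \<le> 0" using le[of 0 x] by auto
    moreover have "f 0 \<in> {0..1}" using im by (metis atLeastAtMost_iff imageI order_refl zero_le_one)
    ultimately show ?thesis by auto
  qed
  have f1: "f 1 = 1"
  proof -
    have "1 \<in> f ` {0..1}" using im by auto
    then obtain x where x: "x \<in> {0..1}" "f x = 1" by auto
    then have "f 1 \<ge> 1" using le[of x 1] by auto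
    moreover have "f 1 \<in> {0..1}" using im by (metis atLeastAtMost_iff imageI order_refl zero_le_one)
    ultimately show ?thesis by auto
  qed
  have range: "f x \<in> {0..1}" if "x \<in> {0..1}" for x using im that by blast
  have "strict_mono f"
  proof (rule strict_monoI)
    fix x y :: real assume "x < y"
    show "f x < f y"
    proof (cases "x \<in> {0..1}"; cases "y \<in> {0..1}")
      assume "x \<in> {0..1}" "y \<in> {0..1}"
      then show ?thesis using sm \<open>x < y\<close> by (simp add: strict_mono_onD)
    next
      assume "x \<in> {0..1}" "y \<notin> {0..1}"
      then show ?thesis using range[of x] out[of y] \<open>x < y\<close> by auto
    next
      assume "x \<notin> {0..1}" "y \<in> {0..1}"
      then show ?thesis using range[of y] out[of x] \<open>x < y\<close> by auto
    next
      assume "x \<notin> {0..1}" "y \<notin> {0..1}"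
      then show ?thesis using out \<open>x < y\<close> by auto
    qed
  qed
  moreover have "surj f"
    unfolding surj_def
  proof
    fix y
    show "\<exists>x. y = f x"
      using im out[of y] by (metis imageE)
  qed
  moreover have "\<forall>x. x \<notin> {0<..<1} \<longrightarrow> f x = x"
    using f0 f1 out by (metis atLeastAtMost_iff greaterThanLessThan_iff order_le_less)
  ultimately show "strict_mono f \<and> surj f \<and> (\<forall>x. x \<notin> {0<..<1} \<longrightarrow> f x = x) \<and> (\<exists>S. breaks f S)"
    using pl unfolding PL_piecewise_linear_iff by blast
next
  assume "strict_mono f \<and> surj f \<and> (\<forall>x. x \<notin> {0<..<1} \<longrightarrow> f x = x) \<and> (\<exists>S. breaks f S)"
  then have sm: "strict_mono f" and surj: "surj f" and out: "\<And>x. x \<notin> {0<..<1} \<Longrightarrow> f x = x"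
    and br: "\<exists>S. breaks f S" by auto
  have f01: "f 0 = 0" "f 1 = 1" using out by auto
  have iff: "f x \<in> {0..1} \<longleftrightarrow> x \<in> {0..1}" for x
    using strict_mono_less_eq[OF sm, of 0 x] strict_mono_less_eq[OF sm, of x 1] f01 by auto
  have im: "f ` {0..1} = {0..1}"
  proof
    show "{0..1} \<subseteq> f ` {0..1}"
    proof
      fix y :: real assume "y \<in> {0..1}"
      moreover obtain x where "y = f x" using surj by (rule surjE)
      ultimately show "y \<in> f ` {0..1}" using iff[of x] by blast
    qed
  qed (use iff in blast)
  have "\<exists>g. homeomorphism {0..1} {0..1} f g"
    using continuous_on_subset[OF strict_mono_surj_continuous_on[OF sm surj]] im
      strict_mono_imp_inj_on[OF sm]
    by (intro homeomorphism_compact) (auto intro: inj_on_subset)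
  moreover have "strict_mono_on {0..1} f" using sm by (simp add: strict_mono_onI strict_monoD)
  moreover have "f x = x" if "x \<notin> {0..1}" for x using out that by auto
  ultimately show "f \<in> PLo_set"
    using br unfolding PLo_set_def PL_piecewise_linear_iff by blast
qed

lemma PLo_simps [simp]:
  "carrier PLo = PLo_set" "mult PLo f g = f \<circ> g" "one PLo = id"
  by (simp_all add: PLo_def)

lemma PLo_comp:
  assumes "f \<in> PLo_set" "g \<in> PLo_set" shows "f \<circ> g \<in> PLo_set"
proof -
  from assms obtain S T where f: "strict_mono f" "surj f" "\<And>x. x \<notin> {0<..<1} \<Longrightarrow> f x = x" "breaks f S"
    and g: "strict_mono g" "surj g" "\<And>x. x \<notin> {0<..<1} \<Longrightarrow> g x = x" "breaks g T"
    unfolding PLo_set_iff by blast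
  have g01: "g 0 = 0" "g 1 = 1" using g(3) by auto
  \<comment> \<open>A break of the composite is a break of \<open>g\<close> or is sent by
    \<open>g\<close> to a break of \<open>f\<close>; the preimage is finite because \<open>g\<close>
    is injective.\<close>
  have "breaks (f \<circ> g) (T \<union> g -` S)"
    unfolding breaks_def
  proof (intro conjI allI impI)
    show "finite (T \<union> g -` S)"
      using f(4) g(4) strict_mono_imp_inj_on[OF g(1)] by (simp add: breaks_def finite_vimageI)
    fix x y assume h: "0 \<le> x \<and> x < y \<and> y \<le> 1 \<and> {x<..<y} \<inter> (T \<union> g -` S) = {}"
    then obtain a b where ab: "\<And>z. z \<in> {x..y} \<Longrightarrow> g z = a * z + b"
      using g(4) unfolding breaks_def by (metis Un_empty inf_sup_distrib1)
    have "0 \<le> g x" "g x < g y" "g y \<le> 1"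
      using h g01 g(1) by (metis strict_mono_less_eq, metis strict_mono_less, metis strict_mono_less_eq)
    moreover have "{g x<..<g y} \<inter> S = {}"
    proof -
      have False if "s \<in> S" "g x < s" "s < g y" for s
      proof -
        obtain z where "s = g z" using g(2) by (meson surjD)
        then show False using h that strict_mono_less[OF g(1)] by auto
      qed
      then show ?thesis by auto
    qed
    ultimately obtain c d where cd: "\<And>z. z \<in> {g x..g y} \<Longrightarrow> f z = c * z + d"
      using f(4) unfolding breaks_def by metis
    have "(f \<circ> g) z = (c * a) * z + (c * b + d)" if "z \<in> {x..y}" for z
    proof -
      have "g z \<in> {g x..g y}" using that strict_mono_less_eq[OF g(1)] by auto
      then show ?thesis using cd ab[OF that] by (simp add: algebra_simps)
    qed
    then show "\<exists>a b. \<forall>z\<in>{x..y}. (f \<circ> g) z = a * z + b" by blast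
  qed
  moreover have "strict_mono (f \<circ> g)" using f(1) g(1) by (simp add: strict_mono_def)
  moreover have "surj (f \<circ> g)" using f(2) g(2) by (rule comp_surj[rotated])
  ultimately show ?thesis using f(3) g(3) unfolding PLo_set_iff by auto
qed

lemma PLo_inv_into:
  assumes "f \<in> PLo_set" shows "inv_into UNIV f \<in> PLo_set"
proof -
  from assms obtain S where f: "strict_mono f" "surj f" "\<And>x. x \<notin> {0<..<1} \<Longrightarrow> f x = x" "breaks f S"
    unfolding PLo_set_iff by blast
  let ?g = "inv_into UNIV f"
  have inj: "inj f" using strict_mono_imp_inj_on[OF f(1)] .
  have gf: "?g (f x) = x" and fg: "f (?g x) = x" for x
    using inj f(2) by (auto simp: surj_f_inv_f)
  have sm: "strict_mono ?g"
    by (rule strict_monoI) (metis fg strict_mono_less[OF f(1)])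
  have out: "?g x = x" if "x \<notin> {0<..<1}" for x using f(3)[OF that] gf by metis
  have g01: "?g 0 = 0" "?g 1 = 1" using out by auto
  have "breaks ?g (f ` S)"
    unfolding breaks_def
  proof (intro conjI allI impI)
    show "finite (f ` S)" using f(4) by (simp add: breaks_def)
    fix x y assume h: "0 \<le> x \<and> x < y \<and> y \<le> 1 \<and> {x<..<y} \<inter> f ` S = {}"
    have le: "0 \<le> ?g x" "?g x < ?g y" "?g y \<le> 1"
      using h g01 sm by (metis strict_mono_less_eq, metis strict_mono_less, metis strict_mono_less_eq)
    have "{?g x<..<?g y} \<inter> S = {}"
    proof -
      have False if "s \<in> S" "?g x < s" "s < ?g y" for s
      proof -
        have "f s \<in> {x<..<y}" using that strict_mono_less[OF f(1)] fg
          by (metis greaterThanLessThan_iff)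
        then show False using h that by blast
      qed
      then show ?thesis by auto
    qed
    with le obtain a b where ab: "\<And>z. z \<in> {?g x..?g y} \<Longrightarrow> f z = a * z + b"
      using f(4) unfolding breaks_def by metis
    have "f (?g x) < f (?g y)" using le(2) f(1) by (simp add: strict_mono_less)
    then have "a \<noteq> 0" using ab[of "?g x"] ab[of "?g y"] le by auto
    have "?g z = (1 / a) * z + (- b / a)" if "z \<in> {x..y}" for z
    proof -
      have "?g z \<in> {?g x..?g y}" using that strict_mono_less_eq[OF sm] by auto
      then have "z = a * ?g z + b" using ab fg by metis
      then show ?thesis using \<open>a \<noteq> 0\<close> by (simp add: field_simps)
    qed
    then show "\<exists>a b. \<forall>z\<in>{x..y}. ?g z = a * z + b" by blast
  qed
  then show ?thesis using sm out inj_imp_surj_inv[OF inj] unfolding PLo_set_iff by blast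
qed

lemma id_PLo: "id \<in> PLo_set"
proof -
  have "\<exists>a b. \<forall>z\<in>{x..y}. id z = a * z + b" for x y :: real
    by (rule exI[of _ 1], rule exI[of _ 0]) simp
  then have "breaks id {}" by (auto simp: breaks_def)
  then show ?thesis by (auto simp: PLo_set_iff strict_mono_def)
qed

lemma PLo_bij: "f \<in> PLo_set \<Longrightarrow> bij f"
  unfolding PLo_set_iff bij_def using strict_mono_imp_inj_on by blast

lemma group_PLo: "group PLo"
proof (rule groupI)
  fix f assume "f \<in> carrier PLo"
  then show "\<exists>g\<in>carrier PLo. g \<otimes>\<^bsub>PLo\<^esub> f = \<one>\<^bsub>PLo\<^esub>"
    using PLo_inv_into PLo_bij by (intro bexI[of _ "inv_into UNIV f"]) (auto simp: bij_def)
qed (auto simp: PLo_comp id_PLo comp_assoc simp del: comp_apply)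

interpretation PLo: group PLo by (rule group_PLo)

lemma PLo_inv_apply [simp]:
  assumes "f \<in> PLo_set"
  shows "(inv\<^bsub>PLo\<^esub> f) (f x) = x" "f ((inv\<^bsub>PLo\<^esub> f) x) = x"
  using PLo.l_inv[of f] PLo.r_inv[of f] assms by (auto simp: fun_eq_iff)

lemma PLo_less [simp]: "f \<in> PLo_set \<Longrightarrow> f x < f y \<longleftrightarrow> x < y"
  and PLo_le [simp]: "f \<in> PLo_set \<Longrightarrow> f x \<le> f y \<longleftrightarrow> x \<le> y"
  and PLo_eq [simp]: "f \<in> PLo_set \<Longrightarrow> f x = f y \<longleftrightarrow> x = y"
  by (simp_all add: PLo_set_iff strict_mono_less strict_mono_less_eq strict_mono_eq)

lemma PLo_inv_fix:
  assumes "f \<in> PLo_set" shows "(inv\<^bsub>PLo\<^esub> f) x = x \<longleftrightarrow> f x = x"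
  using PLo_inv_apply[OF assms] by metis

lemma PLo_out: "f \<in> PLo_set \<Longrightarrow> x \<notin> {0<..<1} \<Longrightarrow> f x = x"
  by (simp add: PLo_set_iff)

lemma PLo_continuous: "f \<in> PLo_set \<Longrightarrow> continuous_on UNIV f"
  by (simp add: PLo_set_iff strict_mono_surj_continuous_on)

section \<open>One-sided slopes at fixed points\<close>

text \<open>Here \<open>a\<close> is the slope on the right of \<open>p\<close> and \<open>b\<close>
  the slope on its left; the instance t = 0 makes \<open>p\<close> a fixed point. Positivity is
  included so that the slopes of the inverse are reciprocals.\<close>

definition has_slopes :: "real \<Rightarrow> (real \<Rightarrow> real) \<Rightarrow> real \<Rightarrow> real \<Rightarrow> bool" where
  "has_slopes p f a b \<longleftrightarrow> 0 < a \<and> 0 < b \<and>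
     (\<exists>e>0. \<forall>t. 0 \<le> t \<and> t \<le> e \<longrightarrow> f (p + t) = p + a * t \<and> f (p - t) = p - b * t)"

lemma PLo_right_slope:
  assumes f: "f \<in> PLo_set" and p: "f p = p"
  shows "\<exists>a>0. \<exists>e>0. \<forall>t. 0 \<le> t \<and> t \<le> e \<longrightarrow> f (p + t) = p + a * t"
proof (cases "0 \<le> p \<and> p < 1")
  case True
  obtain S where fin: "finite S" and S: "\<And>x y. 0 \<le> x \<and> x < y \<and> y \<le> 1 \<and> {x<..<y} \<inter> S = {} \<Longrightarrow>
        (\<exists>a b. \<forall>z\<in>{x..y}. f z = a * z + b)"
    using f unfolding PLo_set_iff breaks_def by blast
  \<comment> \<open>The candidates for the next break to the right of \<open>p\<close>; the end
    point 1 makes the set nonempty and keeps \<open>q\<close> inside [0,1], where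
    \<open>breaks\<close> applies.\<close>
  define T where "T = insert 1 {s \<in> S. p < s}"
  define q where "q = Min T"
  have T: "finite T" "T \<noteq> {}" using fin by (auto simp: T_def)
  have q: "p < q" "q \<le> 1" and le: "\<And>s. s \<in> S \<Longrightarrow> p < s \<Longrightarrow> q \<le> s"
    using Min_in[OF T] Min_le[OF T(1)] True unfolding q_def by (auto simp: T_def)
  have "{p<..<q} \<inter> S = {}" using le by force
  then obtain a b where ab: "\<And>z. z \<in> {p..q} \<Longrightarrow> f z = a * z + b"
    using S[of p q] q True by blast
  have pp: "a * p + b = p" using ab[of p] p q by simp
  have "f p < f q" using f q by simp
  then have "0 < a * (q - p)" using ab[of p] ab[of q] q by (simp add: right_diff_distrib)
  then have "0 < a" using q(1) by (simp add: zero_less_mult_iff)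
  moreover have "f (p + t) = p + a * t" if "0 \<le> t" "t \<le> q - p" for t
    using ab[of "p + t"] that pp by (simp add: algebra_simps)
  ultimately show ?thesis using q by (intro exI[of _ a] conjI exI[of _ "q - p"]) auto
next
  case False
  have "f (p + t) = p + 1 * t" if "0 \<le> t" "t \<le> (if p < 0 then - p else 1)" for t
    using PLo_out[OF f, of "p + t"] that False by (auto split: if_splits)
  then show ?thesis
    by (intro exI[of _ 1] conjI exI[of _ "if p < 0 then - p else 1"]) auto
qed

lemma PLo_left_slope:
  assumes f: "f \<in> PLo_set" and p: "f p = p"
  shows "\<exists>b>0. \<exists>e>0. \<forall>t. 0 \<le> t \<and> t \<le> e \<longrightarrow> f (p - t) = p - b * t"
proof (cases "0 < p \<and> p \<le> 1")
  case True
  obtain S where fin: "finite S" and S: "\<And>x y. 0 \<le> x \<and> x < y \<and> y \<le> 1 \<and> {x<..<y} \<inter> S = {} \<Longrightarrow>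
        (\<exists>a b. \<forall>z\<in>{x..y}. f z = a * z + b)"
    using f unfolding PLo_set_iff breaks_def by blast
  define T where "T = insert 0 {s \<in> S. s < p}"
  define q where "q = Max T"
  have T: "finite T" "T \<noteq> {}" using fin by (auto simp: T_def)
  have q: "q < p" "0 \<le> q" and le: "\<And>s. s \<in> S \<Longrightarrow> s < p \<Longrightarrow> s \<le> q"
    using Max_in[OF T] Max_ge[OF T(1)] True unfolding q_def by (auto simp: T_def)
  have "{q<..<p} \<inter> S = {}" using le by force
  then obtain a b where ab: "\<And>z. z \<in> {q..p} \<Longrightarrow> f z = a * z + b"
    using S[of q p] q True by blast
  have pp: "a * p + b = p" using ab[of p] p q by simp
  have "f q < f p" using f q by simp
  then have "0 < a * (p - q)" using ab[of p] ab[of q] q by (simp add: right_diff_distrib)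
  then have "0 < a" using q(1) by (simp add: zero_less_mult_iff)
  moreover have "f (p - t) = p - a * t" if "0 \<le> t" "t \<le> p - q" for t
    using ab[of "p - t"] that pp by (simp add: algebra_simps)
  ultimately show ?thesis using q by (intro exI[of _ a] conjI exI[of _ "p - q"]) auto
next
  case False
  have "f (p - t) = p - 1 * t" if "0 \<le> t" "t \<le> (if 1 < p then p - 1 else 1)" for t
    using PLo_out[OF f, of "p - t"] that False by (auto split: if_splits)
  then show ?thesis
    by (intro exI[of _ 1] conjI exI[of _ "if 1 < p then p - 1 else 1"]) auto
qed

lemma PLo_has_slopes:
  assumes f: "f \<in> PLo_set" and p: "f p = p"
  obtains a b where "has_slopes p f a b"
proof -
  obtain a e where a: "0 < a" "0 < e" "\<And>t. 0 \<le> t \<Longrightarrow> t \<le> e \<Longrightarrow> f (p + t) = p + a * t"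
    using PLo_right_slope[OF assms] by blast
  obtain b d where b: "0 < b" "0 < d" "\<And>t. 0 \<le> t \<Longrightarrow> t \<le> d \<Longrightarrow> f (p - t) = p - b * t"
    using PLo_left_slope[OF assms] by blast
  have "has_slopes p f a b" unfolding has_slopes_def
    using a b by (intro conjI exI[of _ "min d e"]) auto
  then show ?thesis by (rule that)
qed

lemma has_slopes_comp:
  assumes "has_slopes p f a b" "has_slopes p g c d"
  shows "has_slopes p (f \<circ> g) (a * c) (b * d)"
proof -
  obtain e where f: "0 < a" "0 < b" "0 < e"
      "\<And>t. 0 \<le> t \<Longrightarrow> t \<le> e \<Longrightarrow> f (p + t) = p + a * t" "\<And>t. 0 \<le> t \<Longrightarrow> t \<le> e \<Longrightarrow> f (p - t) = p - b * t"
    using assms(1) unfolding has_slopes_def by blast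
  obtain e' where g: "0 < c" "0 < d" "0 < e'"
      "\<And>t. 0 \<le> t \<Longrightarrow> t \<le> e' \<Longrightarrow> g (p + t) = p + c * t" "\<And>t. 0 \<le> t \<Longrightarrow> t \<le> e' \<Longrightarrow> g (p - t) = p - d * t"
    using assms(2) unfolding has_slopes_def by blast
  have "(f \<circ> g) (p + t) = p + (a * c) * t \<and> (f \<circ> g) (p - t) = p - (b * d) * t"
    if t: "0 \<le> t" "t \<le> min e' (min (e / c) (e / d))" for t
  proof -
    have "c * t \<le> e" "d * t \<le> e" using t f g by (auto simp: field_simps)
    then show ?thesis using t f g by simp
  qed
  then show ?thesis unfolding has_slopes_def using f g
    by (intro conjI exI[of _ "min e' (min (e / c) (e / d))"]) auto
qed

lemma has_slopes_inv:
  assumes "has_slopes p f a b" "f \<in> PLo_set"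
  shows "has_slopes p (inv\<^bsub>PLo\<^esub> f) (1 / a) (1 / b)"
proof -
  obtain e where f: "0 < a" "0 < b" "0 < e"
      "\<And>t. 0 \<le> t \<Longrightarrow> t \<le> e \<Longrightarrow> f (p + t) = p + a * t" "\<And>t. 0 \<le> t \<Longrightarrow> t \<le> e \<Longrightarrow> f (p - t) = p - b * t"
    using assms(1) unfolding has_slopes_def by blast
  have "(inv\<^bsub>PLo\<^esub> f) (p + t) = p + (1 / a) * t \<and> (inv\<^bsub>PLo\<^esub> f) (p - t) = p - (1 / b) * t"
    if t: "0 \<le> t" "t \<le> min (a * e) (b * e)" for t
  proof -
    have "f (p + t / a) = p + t" "f (p - t / b) = p - t"
      using f(4)[of "t / a"] f(5)[of "t / b"] t f(1-3) by (auto simp: field_simps)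
    then show ?thesis using PLo_inv_apply(1)[OF assms(2)] by (metis mult_1 times_divide_eq_left)
  qed
  then show ?thesis unfolding has_slopes_def using f
    by (intro conjI exI[of _ "min (a * e) (b * e)"]) auto
qed

text \<open>This turns slopes into topology: trivial slopes on both sides keep \<open>p\<close> out
  of the closure of the support.\<close>

lemma has_slopes_one_iff:
  "has_slopes p f 1 1 \<longleftrightarrow> (\<exists>e>0. \<forall>x. \<bar>x - p\<bar> \<le> e \<longrightarrow> f x = x)"
proof
  assume "has_slopes p f 1 1"
  then obtain e where e: "0 < e" "\<And>t. 0 \<le> t \<Longrightarrow> t \<le> e \<Longrightarrow> f (p + t) = p + t \<and> f (p - t) = p - t"
    unfolding has_slopes_def by auto
  have "f x = x" if "\<bar>x - p\<bar> \<le> e" for x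
    using e(2)[of "\<bar>x - p\<bar>"] that by (cases "x \<ge> p") auto
  then show "\<exists>e>0. \<forall>x. \<bar>x - p\<bar> \<le> e \<longrightarrow> f x = x" using e(1) by blast
next
  assume "\<exists>e>0. \<forall>x. \<bar>x - p\<bar> \<le> e \<longrightarrow> f x = x"
  then obtain e where e: "0 < e" "\<And>x. \<bar>x - p\<bar> \<le> e \<Longrightarrow> f x = x" by blast
  then show "has_slopes p f 1 1"
    unfolding has_slopes_def by (intro conjI exI[of _ e]) auto
qed

text \<open>One-sided slopes at a common fixed point are multiplicative, hence trivial on commutators.\<close>

lemma derived_PLo_has_slopes_one:
  assumes G: "subgroup G PLo" and k: "k \<in> derived PLo G" and p: "\<And>g. g \<in> G \<Longrightarrow> g p = p"
  shows "has_slopes p k 1 1"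
proof -
  interpret G: subgroup G PLo by (rule G)
  have GP: "g \<in> PLo_set" if "g \<in> G" for g using G.subset that by auto
  let ?N = "{k \<in> PLo_set. has_slopes p k 1 1}"
  have "subgroup ?N PLo"
  proof (rule PLo.subgroupI)
    have "has_slopes p id 1 1" by (auto simp: has_slopes_one_iff intro: exI[of _ 1])
    then show "?N \<noteq> {}" using id_PLo by blast
  next
    fix a assume "a \<in> ?N" then show "inv\<^bsub>PLo\<^esub> a \<in> ?N"
      using has_slopes_inv[of p a 1 1] PLo.inv_closed[of a] by simp
  next
    fix a b assume "a \<in> ?N" "b \<in> ?N" then show "a \<otimes>\<^bsub>PLo\<^esub> b \<in> ?N"
      using has_slopes_comp[of p a 1 1 b 1 1] PLo_comp by simp
  qed auto
  moreover have "derived_set PLo G \<subseteq> ?N"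
  proof
    fix x assume "x \<in> derived_set PLo G"
    then obtain f g where fg: "f \<in> G" "g \<in> G" and x: "x = f \<circ> g \<circ> inv\<^bsub>PLo\<^esub> f \<circ> inv\<^bsub>PLo\<^esub> g"
      by auto
    obtain a b where f: "has_slopes p f a b" using PLo_has_slopes GP p fg by metis
    obtain c d where g: "has_slopes p g c d" using PLo_has_slopes GP p fg by metis
    have pos: "a > 0" "b > 0" "c > 0" "d > 0" using f g by (auto simp: has_slopes_def)
    have "has_slopes p x (a * c * (1 / a) * (1 / c)) (b * d * (1 / b) * (1 / d))"
      unfolding x using fg GP by (intro has_slopes_comp has_slopes_inv f g) auto
    then have "has_slopes p x 1 1" using pos by simp
    moreover have "x \<in> PLo_set" unfolding x
      using fg GP PLo.inv_closed by (intro PLo_comp) auto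
    ultimately show "x \<in> ?N" by simp
  qed
  ultimately have "derived PLo G \<subseteq> ?N"
    unfolding derived_def by (intro PLo.generate_subgroup_incl)
  then show ?thesis using k by blast
qed

section \<open>Displacing intervals\<close>

context linorder
begin

lemma eventually_displaced_up:
  fixes P :: "int \<Rightarrow> 'a \<Rightarrow> 'a" and g :: "'a \<Rightarrow> 'a" and s :: int
  assumes P0: "\<And>x. P 0 x = x" and Padd: "\<And>i j x. P (i + j) x = P i (P j x)"
    and Pmono: "\<And>i x y. x \<le> y \<Longrightarrow> P i x \<le> P i y"
    and gmono: "\<And>x y. x \<le> y \<Longrightarrow> g x \<le> g y"
    and cd: "c \<le> d" "d < P 1 c" and s: "s = 1 \<or> s = -1"
  shows "\<exists>M. \<forall>m\<ge>M. \<exists>N. \<forall>n\<ge>N.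
    d < P (s * int n) (g (P (int m) c)) \<or> P (s * int n) (g (P (int m) d)) < c"
\<comment> \<open>The orbit of \<open>c\<close> under \<open>P\<close> is cofinal in an interval invariant under \<open>P\<close>; for large \<open>m\<close>, the map
  \<open>g\<close> sends \<open>P m c\<close> above that interval, or \<open>P m d\<close> below it, or both of them into it.\<close>
proof -
  have up: "P i c \<le> P j c" if "i \<le> j" for i j
    using that
  proof (induction rule: int_ge_induct)
    case base show ?case by simp
  next
    case (step k)
    have "P k c \<le> P k (P 1 c)" using Pmono cd by auto
    then show ?case using step Padd[of k 1 c] by auto
  qed
  have neg: "P (-1) c < c"
  proof (rule ccontr)
    assume "\<not> P (-1) c < c"
    then have "P 1 c \<le> P 1 (P (-1) c)" using Pmono by simp
    then show False using Padd[of 1 "-1" c] P0 cd by auto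
  qed
  \<comment> \<open>Since \<open>d\<close> lies below \<open>P 1 c\<close>, the orbit of
    \<open>c\<close> alone controls that of \<open>d\<close>, at the price of one step.\<close>
  have dP: "g (P m d) \<le> g (P (m + 1) c)" for m
    using gmono Pmono[of d "P 1 c" m] cd Padd[of m 1 c] by simp
  consider (above) M :: nat where "\<And>k. P k c \<le> g (P (int M) c)"
    | (within) M :: nat and k where "P k c \<le> g (P (int M) c)" "\<And>m :: nat. \<exists>l. g (P (int m) c) < P l c"
    | (below) "\<And>(m :: nat) k. g (P (int m) c) \<le> P k c"
    by (meson local.le_less_linear local.less_imp_le)
  then show ?thesis
  proof cases
    case above
    have "d < P (s * int n) (g (P (int m) c))" if "m \<ge> M" for m n
    proof -
      \<comment> \<open>The exponent is chosen so that applying \<open>P (s * int n)\<close> lands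
        on \<open>P 1 c\<close>, which exceeds \<open>d\<close>.\<close>
      have "P (1 - s * int n) c \<le> g (P (int m) c)"
        using above[of "1 - s * int n"] gmono[OF up[of "int M" "int m"]] that by auto
      then have "P (s * int n) (P (1 - s * int n) c) \<le> P (s * int n) (g (P (int m) c))"
        by (rule Pmono)
      then show ?thesis using cd by (simp flip: Padd)
    qed
    then show ?thesis by blast
  next
    case within
    have "\<exists>N. \<forall>n\<ge>N. d < P (s * int n) (g (P (int m) c)) \<or> P (s * int n) (g (P (int m) d)) < c"
      if m: "m \<ge> M" for m
    proof -
      obtain l where l: "g (P (int (Suc m)) c) < P l c" using within(2) by blast
      have k: "P k c \<le> g (P (int m) c)"
        using within(1) gmono[OF up[of "int M" "int m"]] m by auto
      \<comment> \<open>For s = 1 the estimate needs n + k \<ge> 1, for s = -1 it needs l - n \<le>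
        -1; the bound on \<open>n\<close> serves both signs.\<close>
      have "d < P (s * int n) (g (P (int m) c)) \<or> P (s * int n) (g (P (int m) d)) < c"
        if n: "n \<ge> nat \<bar>l\<bar> + nat \<bar>k\<bar> + 1" for n
        using s
      proof
        assume s: "s = 1"
        have "P (int n + k) c \<le> P (int n) (g (P (int m) c))" using Pmono[OF k] Padd by simp
        moreover have "P 1 c \<le> P (int n + k) c" by (rule up) (use n in linarith)
        ultimately show ?thesis using cd s by auto
      next
        assume s: "s = -1"
        have "g (P (int m) d) \<le> P l c" using dP[of "int m"] l by (auto simp: add.commute)
        then have "P (- int n) (g (P (int m) d)) \<le> P (- int n + l) c" unfolding Padd by (rule Pmono)
        moreover have "P (- int n + l) c \<le> P (-1) c" by (rule up) (use n in linarith)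
        ultimately show ?thesis using neg s by auto
      qed
      then show ?thesis by blast
    qed
    then show ?thesis by blast
  next
    case below
    have "P (s * int n) (g (P (int m) d)) < c" for m n
    proof -
      have "g (P (int m) d) \<le> P (- s * int n - 1) c"
        using dP[of "int m"] below[of "Suc m" "- s * int n - 1"] by (auto simp: add.commute)
      then have "P (s * int n) (g (P (int m) d)) \<le> P (s * int n) (P (- s * int n - 1) c)"
        by (rule Pmono)
      then show ?thesis using neg by (simp flip: Padd)
    qed
    then show ?thesis by blast
  qed
qed

text \<open>Reversing the order and exchanging \<open>c\<close> with \<open>d\<close> swaps the two
  alternatives of the hypothesis and those of the conclusion. The argument is carried out in an
  arbitrary linear order so that it can be applied to the dual one.\<close>

lemma eventually_displaced:
  fixes P :: "int \<Rightarrow> 'a \<Rightarrow> 'a" and g :: "'a \<Rightarrow> 'a" and s :: int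
  assumes P0: "\<And>x. P 0 x = x" and Padd: "\<And>i j x. P (i + j) x = P i (P j x)"
    and Pmono: "\<And>i x y. x \<le> y \<Longrightarrow> P i x \<le> P i y"
    and gmono: "\<And>x y. x \<le> y \<Longrightarrow> g x \<le> g y"
    and cd: "c \<le> d" "d < P 1 c \<or> P 1 d < c" and s: "s = 1 \<or> s = -1"
  shows "\<exists>M. \<forall>m\<ge>M. \<exists>N. \<forall>n\<ge>N.
    d < P (s * int n) (g (P (int m) c)) \<or> P (s * int n) (g (P (int m) d)) < c"
proof -
  have "\<exists>M. \<forall>m\<ge>M. \<exists>N. \<forall>n\<ge>N.
      P (s * int n) (g (P (int m) d)) < c \<or> d < P (s * int n) (g (P (int m) c))"
    if "P 1 d < c"
    by (rule linorder.eventually_displaced_up[OF dual_linorder, of P g c d s])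
      (use assms that in auto)
  then show ?thesis
    using eventually_displaced_up[of P g c d s] assms by (metis (no_types, lifting))
qed

end

section \<open>Integer powers and simultaneous displacement\<close>

lemma PLo_pow:
  fixes i j :: int
  assumes "f \<in> PLo_set"
  shows PLo_pow_closed [simp]: "f [^]\<^bsub>PLo\<^esub> i \<in> PLo_set"
    and PLo_pow_add: "(f [^]\<^bsub>PLo\<^esub> (i + j)) x = (f [^]\<^bsub>PLo\<^esub> i) ((f [^]\<^bsub>PLo\<^esub> j) x)"
    and PLo_pow_minus [simp]: "(f [^]\<^bsub>PLo\<^esub> (- i)) ((f [^]\<^bsub>PLo\<^esub> i) x) = x"
      "(f [^]\<^bsub>PLo\<^esub> i) ((f [^]\<^bsub>PLo\<^esub> (- i)) x) = x"
proof -
  show closed: "f [^]\<^bsub>PLo\<^esub> i \<in> PLo_set" for i :: int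
    using PLo.int_pow_closed[of f i] assms by simp
  show add: "(f [^]\<^bsub>PLo\<^esub> (i + j)) x = (f [^]\<^bsub>PLo\<^esub> i) ((f [^]\<^bsub>PLo\<^esub> j) x)" for i j :: int and x
    using PLo.int_pow_mult[of f i j] assms by simp
  show "(f [^]\<^bsub>PLo\<^esub> (- i)) ((f [^]\<^bsub>PLo\<^esub> i) x) = x" "(f [^]\<^bsub>PLo\<^esub> i) ((f [^]\<^bsub>PLo\<^esub> (- i)) x) = x"
    using add[of "- i" i x] add[of i "- i" x] by simp_all
qed

lemma PLo_pow_one: "f \<in> PLo_set \<Longrightarrow> f [^]\<^bsub>PLo\<^esub> (1::int) = f"
  using PLo.int_pow_1[of f] by simp

lemma PLo_pow_ge:
  assumes f: "f \<in> PLo_set" and "z \<le> (f [^]\<^bsub>PLo\<^esub> (e::int)) z"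
  shows "z \<le> (f [^]\<^bsub>PLo\<^esub> (e * int n)) z"
proof (induction n)
  case (Suc n)
  have "(f [^]\<^bsub>PLo\<^esub> e) z \<le> (f [^]\<^bsub>PLo\<^esub> e) ((f [^]\<^bsub>PLo\<^esub> (e * int n)) z)"
    using Suc f by simp
  also have "\<dots> = (f [^]\<^bsub>PLo\<^esub> (e * int (Suc n))) z"
    using PLo_pow_add[OF f, of e "e * int n" z] by (simp add: distrib_left)
  finally show ?case using assms by linarith
qed simp

lemma PLo_pow_sign:
  assumes f: "f \<in> PLo_set"
  obtains e :: int where "e = 1 \<or> e = -1" "z \<le> (f [^]\<^bsub>PLo\<^esub> e) z"
proof (cases "z \<le> f z")
  case True
  then show ?thesis using that[of 1] f by (simp add: PLo_pow_one)
next
  case False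
  have "(f [^]\<^bsub>PLo\<^esub> (- 1 :: int)) (f z) = z"
    using PLo_pow_minus(1)[OF f, of 1 z] f by (simp add: PLo_pow_one)
  moreover have "(f [^]\<^bsub>PLo\<^esub> (- 1 :: int)) (f z) \<le> (f [^]\<^bsub>PLo\<^esub> (- 1 :: int)) z"
    using False f by simp
  ultimately show ?thesis using that[of "-1"] by simp
qed

text \<open>If \<open>f\<close> displaces the intervals in \<open>J\<close> and \<open>d < g c\<close>, then \<open>f\<^sup>\<epsilon>\<^sup>n \<circ> g \<circ> f\<^sup>\<delta>\<^sup>m\<close> displaces
  all of them and \<open>[c, d]\<close>: the signs are chosen so that neither power moves its argument down
  when starting from \<open>c\<close>, and \<open>n\<close> has to be large depending on the large \<open>m\<close>.\<close>

lemma simultaneous_displacement: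
  assumes G: "subgroup G PLo" and J: "finite J"
    and "\<And>c d. (c, d) \<in> J \<Longrightarrow> c \<le> d \<and> (\<exists>g\<in>G. d < g c)"
  shows "\<exists>h\<in>G. \<forall>(c, d)\<in>J. d < h c \<or> h d < c"
  using J assms(3)
proof (induction rule: finite_induct)
  case empty
  show ?case using subgroup.one_closed[OF G] by auto
next
  case (insert cd J)
  obtain c d where cd: "cd = (c, d)" by (cases cd)
  obtain f where f: "f \<in> G" and fJ: "\<And>c d. (c, d) \<in> J \<Longrightarrow> d < f c \<or> f d < c"
    using insert by blast
  obtain g where g: "g \<in> G" "d < g c" using insert.prems cd by blast
  have [simp]: "f \<in> PLo_set" "g \<in> PLo_set" using f g subgroup.subset[OF G] by auto
  obtain \<delta> :: int where \<delta>: "\<delta> = 1 \<or> \<delta> = -1" "c \<le> (f [^]\<^bsub>PLo\<^esub> \<delta>) c"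
    by (rule PLo_pow_sign[of f c]) simp
  obtain \<epsilon> :: int where \<epsilon>: "\<epsilon> = 1 \<or> \<epsilon> = -1" "g c \<le> (f [^]\<^bsub>PLo\<^esub> \<epsilon>) (g c)"
    by (rule PLo_pow_sign[of f "g c"]) simp
  define h where "h m n = f [^]\<^bsub>PLo\<^esub> (\<epsilon> * int n) \<circ> g \<circ> f [^]\<^bsub>PLo\<^esub> (\<delta> * int m)" for m n
  define D where "D m n p \<longleftrightarrow> snd p < h m n (fst p) \<or> h m n (snd p) < fst p" for m n p
  have "\<forall>\<^sub>F m in sequentially. \<forall>\<^sub>F n in sequentially. D m n p" if p: "p \<in> J" for p
  proof -
    \<comment> \<open>Positive exponents of \<open>P\<close> are powers of \<open>f\<close> with
      sign \<delta>, as on the right of \<open>g\<close>. The powers on the left of \<open>g\<close>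
      have sign \<epsilon>, which in terms of \<open>P\<close> is the sign \<epsilon> * \<delta>,
      because \<delta> squares to 1.\<close>
    define P where "P i = f [^]\<^bsub>PLo\<^esub> (\<delta> * i)" for i
    obtain c' d' where p': "p = (c', d')" by (cases p)
    have le: "c' \<le> d'" using insert.prems[of c' d'] p p' by simp
    have disp: "d' < P 1 c' \<or> P 1 d' < c'"
      using \<delta>(1)
    proof
      assume "\<delta> = 1"
      then show ?thesis using fJ p p' by (auto simp: P_def PLo_pow_one)
    next
      assume "\<delta> = -1"
      then have inv: "P 1 (f x) = x" for x
        using PLo_pow_minus(1)[of f 1 x] by (simp add: P_def PLo_pow_one)
      have "P 1 x < P 1 y \<longleftrightarrow> x < y" for x y by (simp add: P_def)
      then show ?thesis using fJ[of c' d'] p p' inv by metis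
    qed
    have "\<exists>M. \<forall>m\<ge>M. \<exists>N. \<forall>n\<ge>N. d' < P (\<epsilon> * \<delta> * int n) (g (P (int m) c')) \<or>
        P (\<epsilon> * \<delta> * int n) (g (P (int m) d')) < c'"
    proof (rule eventually_displaced[of P g c' d' "\<epsilon> * \<delta>"])
      show "P (i + j) x = P i (P j x)" for i j x
        by (simp add: P_def distrib_left PLo_pow_add)
    qed (use \<delta> \<epsilon> le disp in \<open>auto simp: P_def\<close>)
    moreover have "P (\<epsilon> * \<delta> * int n) = f [^]\<^bsub>PLo\<^esub> (\<epsilon> * int n)" for n
      using \<delta>(1) by (auto simp: P_def)
    ultimately show ?thesis unfolding D_def h_def eventually_sequentially by (simp add: P_def p')
  qed
  then have "\<forall>\<^sub>F m in sequentially. \<forall>\<^sub>F n in sequentially. \<forall>p\<in>J. D m n p"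
    using insert.hyps(1) by (simp add: eventually_ball_finite_distrib)
  then obtain m n where D: "\<And>p. p \<in> J \<Longrightarrow> D m n p"
    unfolding eventually_sequentially by blast
  \<comment> \<open>The new interval is displaced for all \<open>m\<close> and \<open>n\<close>:
    neither power moves the point tracked from \<open>c\<close> down, and \<open>g\<close> takes it
    past \<open>d\<close>.\<close>
  have "c \<le> (f [^]\<^bsub>PLo\<^esub> (\<delta> * int m)) c" using \<delta>(2) by (simp add: PLo_pow_ge)
  then have "(f [^]\<^bsub>PLo\<^esub> (\<epsilon> * int n)) (g c) \<le> h m n c" by (simp add: h_def)
  moreover have "g c \<le> (f [^]\<^bsub>PLo\<^esub> (\<epsilon> * int n)) (g c)" using \<epsilon>(2) by (simp add: PLo_pow_ge)
  ultimately have "D m n (c, d)" using g(2) by (simp add: D_def)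
  moreover have "h m n \<in> G"
    using subgroup.m_closed[OF G] PLo.subgroup_int_pow_closed[OF G f] g(1)
    by (simp add: h_def)
  ultimately show ?case using D cd unfolding D_def by (intro bexI[of _ "h m n"]) fastforce+
qed

text \<open>If the orbit of \<open>c\<close> stayed below \<open>d\<close>, its supremum would lie
  in [c, d]; as \<open>G\<close> permutes the orbit and preserves order, that supremum would be a
  common fixed point.\<close>

lemma moves_past:
  assumes G: "subgroup G PLo" and cd: "c \<le> d" and nofix: "\<And>p. c \<le> p \<Longrightarrow> p \<le> d \<Longrightarrow> \<exists>g\<in>G. g p \<noteq> p"
  shows "\<exists>g\<in>G. d < g c"
proof (rule ccontr)
  assume "\<not> (\<exists>g\<in>G. d < g c)"
  then have le: "g c \<le> d" if "g \<in> G" for g using that by force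
  have GP: "g \<in> PLo_set" if "g \<in> G" for g using subgroup.subset[OF G] that by auto
  define s where "s = (SUP g\<in>G. g c)"
  have ne: "G \<noteq> {}" using subgroup.one_closed[OF G] by auto
  have bdd: "bdd_above ((\<lambda>g. g c) ` G)" using le by (auto intro: bdd_aboveI[of _ d])
  have ub: "g c \<le> s" if "g \<in> G" for g unfolding s_def using bdd that by (rule cSUP_upper2) simp
  have "s \<le> d" unfolding s_def using ne le by (rule cSUP_least)
  moreover have "c \<le> s" using ub[of id] subgroup.one_closed[OF G] by simp
  moreover have upper: "h s \<le> s" if h: "h \<in> G" for h
  proof -
    have hi: "inv\<^bsub>PLo\<^esub> h \<in> G" using subgroup.m_inv_closed[OF G h] .
    \<comment> \<open>Shown for every element of \<open>G\<close>, with \<open>h\<close> rebound;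
      the instance for the inverse of the outer \<open>h\<close> gives the upper bound.\<close>
    have "s \<le> h s" if "h \<in> G" for h
      unfolding s_def
    proof (rule cSUP_least[OF ne])
      fix g assume g: "g \<in> G"
      have "inv\<^bsub>PLo\<^esub> h \<circ> g \<in> G"
        using subgroup.m_closed[OF G subgroup.m_inv_closed[OF G that] g] by simp
      then have "(inv\<^bsub>PLo\<^esub> h) (g c) \<le> s" using ub by fastforce
      then have "h ((inv\<^bsub>PLo\<^esub> h) (g c)) \<le> h s" using GP[OF that] by (simp only: PLo_le)
      then show "g c \<le> h (SUP g\<in>G. g c)" using GP[OF that] by (simp add: s_def)
    qed
    from this[OF hi] have "h s \<le> h ((inv\<^bsub>PLo\<^esub> h) s)" using GP[OF h] by (simp only: PLo_le)
    then show ?thesis by (simp only: PLo_inv_apply(2)[OF GP[OF h]])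
  qed
  moreover have "s \<le> h s" if h: "h \<in> G" for h
  proof -
    have "(inv\<^bsub>PLo\<^esub> h) s \<le> s" using upper subgroup.m_inv_closed[OF G h] by blast
    then have "h ((inv\<^bsub>PLo\<^esub> h) s) \<le> h s" using GP[OF h] by (simp only: PLo_le)
    then show ?thesis by (simp only: PLo_inv_apply(2)[OF GP[OF h]])
  qed
  ultimately show False using nofix[of s] by (meson antisym)
qed

lemma displaced_by_powers_aux:
  assumes h: "h \<in> PLo_set" and disp: "d < h c" and xy: "c \<le> d" "c \<le> x" "x \<le> d"
  shows "d < (h [^]\<^bsub>PLo\<^esub> (1 + int n)) x"
proof (induction n)
  case 0
  have "h c \<le> h x" using h xy by simp
  then have "d < h x" using disp by linarith
  then show ?case using h by (simp add: PLo_pow_one)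
next
  case (Suc n)
  then have "h c \<le> h ((h [^]\<^bsub>PLo\<^esub> (1 + int n)) x)" using h xy by (simp only: PLo_le)
  then have "d < h ((h [^]\<^bsub>PLo\<^esub> (1 + int n)) x)" using disp by linarith
  then show ?case using PLo_pow_add[OF h, of 1 "1 + int n" x] h by (simp add: PLo_pow_one)
qed

text \<open>If \<open>d < h c\<close>, a point that has passed \<open>d\<close> never returns,
  because \<open>h\<close> maps everything above \<open>c\<close> beyond \<open>d\<close>. Negative
  exponents follow by exchanging \<open>x\<close> with its image, and the case
  \<open>h d < c\<close> by passing to the inverse.\<close>

lemma displaced_by_powers:
  fixes k :: int
  assumes h: "h \<in> PLo_set" and disp: "d < h c \<or> h d < c" and cd: "c \<le> d" and k: "k \<noteq> 0"
    and x: "c \<le> x" "x \<le> d" and y: "c \<le> (h [^]\<^bsub>PLo\<^esub> k) x" "(h [^]\<^bsub>PLo\<^esub> k) x \<le> d"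
  shows False
proof -
  have pos: False if h: "h \<in> PLo_set" "d < h c" and x: "c \<le> x" "x \<le> d"
    and y: "c \<le> (h [^]\<^bsub>PLo\<^esub> k) x" "(h [^]\<^bsub>PLo\<^esub> k) x \<le> d" and k: "k \<noteq> 0" for h x and k :: int
  proof (cases "k > 0")
    case True
    then show False using displaced_by_powers_aux[OF h cd x, of "nat (k - 1)"] y by simp
  next
    case False
    then show False
      using displaced_by_powers_aux[OF h cd y, of "nat (- k - 1)"] x k PLo_pow_minus(1)[OF h(1), of k x]
      by simp
  qed
  show False
  proof (cases "d < h c")
    case True
    show False by (rule pos[OF h True x y k])
  next
    case False
    define h' where "h' = inv\<^bsub>PLo\<^esub> h"
    have h': "h' \<in> PLo_set" using PLo.inv_closed[of h] h by (simp add: h'_def)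
    have "h' (h d) < h' c" using False disp h' by simp
    then have "d < h' c" using h by (simp add: h'_def)
    moreover have "h' [^]\<^bsub>PLo\<^esub> (- k) = h [^]\<^bsub>PLo\<^esub> k"
      using PLo.int_pow_inv[of h "- k"] PLo.int_pow_neg[of h k] PLo.int_pow_closed[of h k]
        h PLo.inv_inv[of "h [^]\<^bsub>PLo\<^esub> k"]
      by (simp add: h'_def)
    ultimately show False using pos[of h' x "- k"] h' x y k by simp
  qed
qed

section \<open>Displacing the support of a finite subset of the derived subgroup\<close>

text \<open>The union of the supports of the elements of \<open>X\<close>, not closed up.\<close>

definition moved :: "('a \<Rightarrow> 'a) set \<Rightarrow> 'a set" where
  "moved X = {x. \<exists>f\<in>X. f x \<noteq> x}"

text \<open>All nonzero powers are treated at once because the translates of the support by distinct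
  powers of \<open>h\<close> must be pairwise disjoint: they carry the factors of the base group of
  a wreath product.\<close>

lemma displacing_element:
  assumes G: "subgroup G PLo" and X: "finite X" "X \<subseteq> derived PLo G"
  shows "\<exists>h\<in>G. \<forall>k::int. k \<noteq> 0 \<longrightarrow> (\<forall>x\<in>moved X. (h [^]\<^bsub>PLo\<^esub> k) x \<notin> moved X)"
proof -
  have GP: "g \<in> PLo_set" if "g \<in> G" for g using subgroup.subset[OF G] that by auto
  have XP: "f \<in> PLo_set" if "f \<in> X" for f
    using X PLo.derived_in_carrier[of G] subgroup.subset[OF G] that by auto
  define F where "F = {p. \<forall>g\<in>G. g p = p}"
  define C where "C = closure (moved X)"
  have "closed (\<Inter>g\<in>G. {p. g p = p})"
    using GP PLo_continuous by (intro closed_INT ballI closed_Collect_eq) auto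
  moreover have "F = (\<Inter>g\<in>G. {p. g p = p})" by (auto simp: F_def)
  ultimately have F: "closed F" by simp
  have "moved X \<subseteq> {0..1}"
  proof
    fix x assume "x \<in> moved X"
    then obtain f where "f \<in> X" "f x \<noteq> x" by (auto simp: moved_def)
    then have "x \<in> {0<..<1}" using PLo_out[OF XP] by blast
    then show "x \<in> {0..1}" by simp
  qed
  then have "bounded (moved X)" by (rule bounded_subset[rotated]) simp
  then have C: "compact C" unfolding C_def by (simp add: compact_closure)
  have CF: "p \<notin> F" if p: "p \<in> C" for p
  proof
    assume "p \<in> F"
    then have one: "has_slopes p f 1 1" if "f \<in> X" for f
      using derived_PLo_has_slopes_one[OF G] X(2) that by (auto simp: F_def)
    have "\<forall>\<^sub>F x in nhds p. f x = x" if f: "f \<in> X" for f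
    proof -
      obtain e where "e > 0" "\<And>x. \<bar>x - p\<bar> \<le> e \<Longrightarrow> f x = x"
        using one[OF f] unfolding has_slopes_one_iff by blast
      then show ?thesis unfolding eventually_nhds_metric dist_real_def by force
    qed
    \<comment> \<open>Finiteness of \<open>X\<close> gives one neighbourhood of \<open>p\<close>
      that all its elements fix pointwise.\<close>
    then have "\<forall>\<^sub>F x in nhds p. \<forall>f\<in>X. f x = x" using X(1) by (simp add: eventually_ball_finite_distrib)
    then obtain U where U: "open U" "p \<in> U" "\<And>x. x \<in> U \<Longrightarrow> \<forall>f\<in>X. f x = x"
      unfolding eventually_nhds by blast
    then have "U \<inter> moved X = {}" by (auto simp: moved_def)
    then have "U \<inter> C = {}" using U(1) unfolding C_def by (simp add: open_Int_closure_eq_empty)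
    then show False using U(2) p by blast
  qed
  have "\<exists>e>0. {x - e..x + e} \<inter> F = {}" if x: "x \<in> C" for x
  proof -
    obtain e where "e > 0" "cball x e \<subseteq> - F"
      using F CF[OF x] open_contains_cball[of "- F"] by (auto simp: open_Compl)
    then show ?thesis by (intro exI[of _ e]) (auto simp: cball_eq_atLeastAtMost)
  qed
  then obtain e where e: "\<And>x. x \<in> C \<Longrightarrow> 0 < e x" "\<And>x. x \<in> C \<Longrightarrow> {x - e x..x + e x} \<inter> F = {}"
    by metis
  obtain T where T: "T \<subseteq> C" "finite T" "C \<subseteq> (\<Union>x\<in>T. {x - e x<..<x + e x})"
    by (rule compactE_image[OF C, of C "\<lambda>x. {x - e x<..<x + e x}"]) (use e(1) in force)+
  \<comment> \<open>Displacing each covering interval is not enough, since a power of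
    \<open>h\<close> could carry one into another. Hence \<open>J\<close> also contains the hull of
    any two of them, as long as it has no common fixed point.\<close>
  define J where "J = {(c, d). (c, d) \<in> (\<lambda>x. x - e x) ` T \<times> (\<lambda>x. x + e x) ` T \<and> c \<le> d \<and> {c..d} \<inter> F = {}}"
  have "finite J" by (rule finite_subset[of _ "(\<lambda>x. x - e x) ` T \<times> (\<lambda>x. x + e x) ` T"])
      (use T(2) in \<open>auto simp: J_def\<close>)
  moreover have "c \<le> d \<and> (\<exists>g\<in>G. d < g c)" if "(c, d) \<in> J" for c d
    using that moves_past[OF G, of c d] unfolding J_def F_def by force
  ultimately have "\<exists>h\<in>G. \<forall>(c, d)\<in>J. d < h c \<or> h d < c" by (rule simultaneous_displacement[OF G])
  then obtain h where h: "h \<in> G" and hJ: "\<And>c d. (c, d) \<in> J \<Longrightarrow> d < h c \<or> h d < c"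
    by blast
  have hP: "h \<in> PLo_set" using GP h .
  have le_case: False
    if x: "x \<in> moved X" and y: "(h [^]\<^bsub>PLo\<^esub> k) x \<in> moved X" and k: "k \<noteq> 0"
      and le: "x \<le> (h [^]\<^bsub>PLo\<^esub> k) x" for x and k :: int
  proof -
    define y where "y = (h [^]\<^bsub>PLo\<^esub> k) x"
    have "x \<in> C" "y \<in> C" using x y closure_subset unfolding C_def y_def by blast+
    then have "x \<in> (\<Union>x\<in>T. {x - e x<..<x + e x})" "y \<in> (\<Union>x\<in>T. {x - e x<..<x + e x})"
      using T(3) by blast+
    then obtain u v where u: "u \<in> T" "u - e u < x" "x < u + e u" and v: "v \<in> T" "v - e v < y" "y < v + e v"
      by auto
    have Fu: "p \<notin> F" if "u - e u \<le> p" "p \<le> u + e u" for p using e(2)[of u] T(1) u(1) that by force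
    have Fv: "p \<notin> F" if "v - e v \<le> p" "p \<le> v + e v" for p using e(2)[of v] T(1) v(1) that by force
    \<comment> \<open>A common fixed point is a barrier that no power of \<open>h\<close> crosses,
      so a point and its image always lie in one fixed-point-free hull belonging to
      \<open>J\<close>.\<close>
    have Fxy: "p \<notin> F" if "x \<le> p" "p < y" for p
    proof
      assume "p \<in> F"
      then have "(h [^]\<^bsub>PLo\<^esub> k) p = p"
        using PLo.subgroup_int_pow_closed[OF G h, of k] by (simp add: F_def)
      moreover have "(h [^]\<^bsub>PLo\<^esub> k) x \<le> (h [^]\<^bsub>PLo\<^esub> k) p" using hP that by simp
      ultimately show False using that(2) by (simp add: y_def)
    qed
    have "p \<notin> F" if "u - e u \<le> p" "p \<le> v + e v" for p
    proof (cases "p < x")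
      case True then show ?thesis using Fu[of p] u that by simp
    next
      case False
      then show ?thesis using Fxy[of p] Fv[of p] v that by (cases "p < y") auto
    qed
    then have "(u - e u, v + e v) \<in> J" using u v le by (auto simp: J_def y_def)
    from displaced_by_powers[OF hP hJ[OF this] _ k, of x] u v le show False by (simp add: y_def)
  qed
  have "(h [^]\<^bsub>PLo\<^esub> k) x \<notin> moved X" if "k \<noteq> 0" "x \<in> moved X" for k :: int and x
  proof
    assume y: "(h [^]\<^bsub>PLo\<^esub> k) x \<in> moved X"
    show False
    proof (cases "x \<le> (h [^]\<^bsub>PLo\<^esub> k) x")
      case True then show False using le_case that y by blast
    next
      case False
      then show False using le_case[of "(h [^]\<^bsub>PLo\<^esub> k) x" "- k"] that y hP by simp
    qed
  qed
  then show ?thesis using h by blast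
qed

section \<open>Embeddings with disjoint supports\<close>

text \<open>\<open>S\<close> only has to contain the supports. It can thus be \<open>moved X\<close>
  for a finite \<open>X\<close>, although the image is usually infinite.\<close>

definition embeds_on :: "'b monoid \<Rightarrow> (real \<Rightarrow> real) set \<Rightarrow> real set \<Rightarrow> ('b \<Rightarrow> real \<Rightarrow> real) \<Rightarrow> bool" where
  "embeds_on A G S \<phi> \<longleftrightarrow> \<phi> \<in> hom A PLo \<and> inj_on \<phi> (carrier A) \<and> \<phi> ` carrier A \<subseteq> G \<and>
     (\<forall>a\<in>carrier A. \<forall>x. x \<notin> S \<longrightarrow> \<phi> a x = x)"

lemma embeds_onD:
  assumes "embeds_on A G S \<phi>" "a \<in> carrier A"
  shows "\<phi> a \<in> PLo_set" "\<phi> a \<in> G" "x \<notin> S \<Longrightarrow> \<phi> a x = x"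
    and "b \<in> carrier A \<Longrightarrow> \<phi> (a \<otimes>\<^bsub>A\<^esub> b) = \<phi> a \<circ> \<phi> b"
    and "b \<in> carrier A \<Longrightarrow> \<phi> a = \<phi> b \<longleftrightarrow> a = b"
  using assms hom_carrier[of \<phi> A PLo] by (auto simp: embeds_on_def hom_mult dest: inj_onD)

lemma embeds_on_mono:
  "embeds_on A G S \<phi> \<Longrightarrow> G \<subseteq> G' \<Longrightarrow> embeds_on A G' S \<phi>"
  unfolding embeds_on_def by blast

lemma embeds_on_conj:
  assumes emb: "embeds_on A G S \<phi>" and h: "h \<in> PLo_set"
    and norm: "\<And>f. f \<in> G \<Longrightarrow> h \<circ> f \<circ> inv\<^bsub>PLo\<^esub> h \<in> G"
  shows "embeds_on A G {x. (inv\<^bsub>PLo\<^esub> h) x \<in> S} (\<lambda>a. h \<circ> \<phi> a \<circ> inv\<^bsub>PLo\<^esub> h)"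
  unfolding embeds_on_def
proof (intro conjI ballI allI impI)
  note emb' = embeds_onD[OF emb]
  have hi: "inv\<^bsub>PLo\<^esub> h \<in> PLo_set" using PLo.inv_closed[of h] h by simp
  show "(\<lambda>a. h \<circ> \<phi> a \<circ> inv\<^bsub>PLo\<^esub> h) \<in> hom A PLo"
    by (rule homI) (auto simp: fun_eq_iff emb'(4) h hi emb'(1) intro!: PLo_comp)
  show "inj_on (\<lambda>a. h \<circ> \<phi> a \<circ> inv\<^bsub>PLo\<^esub> h) (carrier A)"
  proof (rule inj_onI)
    fix a b assume ab: "a \<in> carrier A" "b \<in> carrier A"
      and eq: "h \<circ> \<phi> a \<circ> inv\<^bsub>PLo\<^esub> h = h \<circ> \<phi> b \<circ> inv\<^bsub>PLo\<^esub> h"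
    have "\<phi> a x = \<phi> b x" for x using fun_cong[OF eq, of "h x"] h by simp
    then show "a = b" using emb'(5)[OF ab] by (simp add: fun_eq_iff)
  qed
  show "(\<lambda>a. h \<circ> \<phi> a \<circ> inv\<^bsub>PLo\<^esub> h) ` carrier A \<subseteq> G" using emb'(2) norm by blast
  show "(h \<circ> \<phi> a \<circ> inv\<^bsub>PLo\<^esub> h) x = x" if "a \<in> carrier A" "x \<notin> {x. (inv\<^bsub>PLo\<^esub> h) x \<in> S}" for a x
    using that emb'(3) h by simp
qed

section \<open>Gluing embeddings with disjoint supports\<close>

text \<open>Used twice: with the integers as index set for the conjugates that form the base of a
  wreath product, and with the positive integers for the summands of the direct sum.\<close>

locale disjoint_embeddings =
  fixes G :: "(real \<Rightarrow> real) set" and I :: "'i set" and A :: "'i \<Rightarrow> 'b monoid"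
    and \<phi> :: "'i \<Rightarrow> 'b \<Rightarrow> real \<Rightarrow> real" and S :: "'i \<Rightarrow> real set"
  assumes subgroup: "subgroup G PLo"
    and group: "\<And>i. i \<in> I \<Longrightarrow> group (A i)"
    and emb: "\<And>i. i \<in> I \<Longrightarrow> embeds_on (A i) G (S i) (\<phi> i)"
    and disj: "\<And>i j x. i \<in> I \<Longrightarrow> j \<in> I \<Longrightarrow> x \<in> S i \<Longrightarrow> x \<in> S j \<Longrightarrow> i = j"
begin

text \<open>The product of the commuting maps \<open>\<phi> i (f i)\<close>, taken pointwise. It
  makes sense for infinitely many nontrivial factors, so multiplicativity needs no finiteness; only
  membership in \<open>G\<close> does.\<close>

definition glue :: "('i \<Rightarrow> 'b) \<Rightarrow> real \<Rightarrow> real" where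
  "glue f x = (if \<exists>i\<in>I. x \<in> S i then let i = (THE i. i \<in> I \<and> x \<in> S i) in \<phi> i (f i) x else x)"

lemma glue_in: assumes "i \<in> I" "x \<in> S i" shows "glue f x = \<phi> i (f i) x"
proof -
  have "(THE i. i \<in> I \<and> x \<in> S i) = i" using assms disj by blast
  then show ?thesis using assms by (auto simp: glue_def Let_def)
qed

lemma glue_out: "(\<And>i. i \<in> I \<Longrightarrow> x \<notin> S i) \<Longrightarrow> glue f x = x"
  by (auto simp: glue_def)

text \<open>If the image of \<open>x\<close> lay outside \<open>S i\<close>, it would be fixed by
  the map, and injectivity would make it equal to \<open>x\<close>.\<close>

lemma preserves:
  assumes i: "i \<in> I" and a: "a \<in> carrier (A i)" shows "\<phi> i a x \<in> S i \<longleftrightarrow> x \<in> S i"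
proof -
  note emb' = embeds_onD[OF emb[OF i] a]
  have "\<phi> i a x = x" if "\<phi> i a x \<notin> S i"
    using emb'(3)[OF that] emb'(1) by simp
  then show ?thesis using emb'(3)[of x] by fastforce
qed

lemma glue_preserves:
  assumes f: "\<And>i. i \<in> I \<Longrightarrow> f i \<in> carrier (A i)" and i: "i \<in> I"
  shows "glue f x \<in> S i \<longleftrightarrow> x \<in> S i"
proof (cases "\<exists>j\<in>I. x \<in> S j")
  case True
  then obtain j where j: "j \<in> I" "x \<in> S j" by blast
  then have "glue f x \<in> S j" using preserves f by (simp add: glue_in)
  then show ?thesis using j disj i by blast
next
  case False
  then show ?thesis by (auto simp: glue_out)
qed

lemma glue_cong: "(\<And>i. i \<in> I \<Longrightarrow> f i = g i) \<Longrightarrow> glue f = glue g"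
proof
  fix x assume "\<And>i. i \<in> I \<Longrightarrow> f i = g i"
  then show "glue f x = glue g x"
    by (cases "\<exists>j\<in>I. x \<in> S j") (auto simp: glue_in glue_out)
qed

lemma glue_mult:
  assumes f: "\<And>i. i \<in> I \<Longrightarrow> f i \<in> carrier (A i)" and g: "\<And>i. i \<in> I \<Longrightarrow> g i \<in> carrier (A i)"
  shows "glue (\<lambda>i. f i \<otimes>\<^bsub>A i\<^esub> g i) = glue f \<circ> glue g"
proof
  fix x
  show "glue (\<lambda>i. f i \<otimes>\<^bsub>A i\<^esub> g i) x = (glue f \<circ> glue g) x"
  proof (cases "\<exists>j\<in>I. x \<in> S j")
    case True
    then obtain j where j: "j \<in> I" "x \<in> S j" by blast
    then have "glue g x \<in> S j" using glue_preserves g by blast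
    then show ?thesis using j embeds_onD(4)[OF emb] f g by (simp add: glue_in)
  next
    case False
    then show ?thesis by (auto simp: glue_out)
  qed
qed

lemma glue_eqD:
  assumes eq: "glue f = glue g" and i: "i \<in> I" and fg: "f i \<in> carrier (A i)" "g i \<in> carrier (A i)"
  shows "f i = g i"
proof -
  have "\<phi> i (f i) x = \<phi> i (g i) x" for x
    using fun_cong[OF eq, of x] i embeds_onD(3)[OF emb[OF i]] fg
    by (cases "x \<in> S i") (auto simp: glue_in)
  then show ?thesis using embeds_onD(5)[OF emb[OF i] fg] by (simp add: fun_eq_iff)
qed

lemma phi_one: assumes i: "i \<in> I" shows "\<phi> i \<one>\<^bsub>A i\<^esub> = id"
proof -
  have "\<phi> i \<in> hom (A i) PLo" using emb[OF i] by (simp add: embeds_on_def)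
  from hom_one[OF this group[OF i] group_PLo] show ?thesis by (simp only: PLo_simps)
qed

text \<open>For finitely supported families \<open>glue f\<close> is a finite product of elements of
  \<open>G\<close>; the induction splits off the factor at \<open>j\<close> by resetting that
  coordinate to the identity.\<close>

lemma glue_closed_aux:
  assumes "finite F"
  shows "(\<And>i. i \<in> I \<Longrightarrow> f i \<in> carrier (A i)) \<Longrightarrow> {i \<in> I. f i \<noteq> \<one>\<^bsub>A i\<^esub>} \<subseteq> F \<Longrightarrow> glue f \<in> G"
  using assms
proof (induction arbitrary: f rule: finite_induct)
  case empty
  then have "f i = \<one>\<^bsub>A i\<^esub>" if "i \<in> I" for i using that by auto
  then have "glue f x = x" for x
    by (cases "\<exists>j\<in>I. x \<in> S j") (auto simp: glue_in glue_out phi_one)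
  then have "glue f = \<one>\<^bsub>PLo\<^esub>" by (simp add: fun_eq_iff)
  then show ?case using subgroup.one_closed[OF subgroup] by (simp only:)
next
  case (insert j F)
  show ?case
  proof (cases "j \<in> I")
    case True
    let ?g = "f(j := \<one>\<^bsub>A j\<^esub>)"
    have g: "?g i \<in> carrier (A i)" if "i \<in> I" for i
      using insert.prems(1) that group[OF True] by (auto simp: group.is_monoid monoid.one_closed)
    have "glue f x = (\<phi> j (f j) \<circ> glue ?g) x" for x
    proof (cases "\<exists>i\<in>I. x \<in> S i")
      case True': True
      then obtain i where i: "i \<in> I" "x \<in> S i" by blast
      show ?thesis
      proof (cases "i = j")
        case True
        then show ?thesis using i by (simp add: glue_in phi_one)
      next
        case False
        have "glue ?g x \<in> S i" using glue_preserves g i by blast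
        then have "glue ?g x \<notin> S j" using disj i \<open>j \<in> I\<close> False by blast
        then show ?thesis
          using i False embeds_onD(3)[OF emb[OF \<open>j \<in> I\<close>] insert.prems(1)[OF \<open>j \<in> I\<close>]]
          by (simp add: glue_in)
      qed
    next
      case False
      then show ?thesis
        using embeds_onD(3)[OF emb[OF \<open>j \<in> I\<close>] insert.prems(1)[OF \<open>j \<in> I\<close>]] True
        by (auto simp: glue_out)
    qed
    then have "glue f = \<phi> j (f j) \<circ> glue ?g" by blast
    moreover have "\<phi> j (f j) \<in> G" using embeds_onD(2)[OF emb] insert.prems(1) True by blast
    moreover have "glue ?g \<in> G" by (rule insert.IH[OF g]) (use insert.prems(2) in auto)
    ultimately show ?thesis using subgroup.m_closed[OF subgroup, of "\<phi> j (f j)" "glue ?g"]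
      by (simp only: PLo_simps)
  next
    case False
    then show ?thesis using insert by (intro insert.IH) auto
  qed
qed

lemma glue_closed:
  assumes "\<And>i. i \<in> I \<Longrightarrow> f i \<in> carrier (A i)" "finite {i \<in> I. f i \<noteq> \<one>\<^bsub>A i\<^esub>}"
  shows "glue f \<in> G"
  by (rule glue_closed_aux[OF assms(2)]) (use assms in auto)

end

section \<open>Restricted wreath products with the integers and their embedding\<close>

lemma wreathZ_simps [simp]:
  "carrier (wreathZ A) = {Wr f n | f n. (\<forall>k. f k \<in> carrier A) \<and> finite {k. f k \<noteq> \<one>\<^bsub>A\<^esub>}}"
  "Wr f m \<otimes>\<^bsub>wreathZ A\<^esub> Wr g n = Wr (\<lambda>k. f k \<otimes>\<^bsub>A\<^esub> g (k - m)) (m + n)"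
  "\<one>\<^bsub>wreathZ A\<^esub> = Wr (\<lambda>_. \<one>\<^bsub>A\<^esub>) 0"
  by (simp_all add: wreathZ_def)

lemma finite_shift: "finite {k::int. P (k - m)} \<longleftrightarrow> finite {k. P k}"
proof -
  have "{k. P (k - m)} = (\<lambda>k. k + m) ` {k. P k}"
    by (auto simp: image_iff) (metis diff_add_cancel)
  then show ?thesis by (simp add: finite_image_iff)
qed

lemma wreathZ_l_inv:
  assumes A: "group A" and f: "\<And>k. f k \<in> carrier A"
  shows "Wr (\<lambda>k. inv\<^bsub>A\<^esub> f (k + m)) (- m) \<otimes>\<^bsub>wreathZ A\<^esub> Wr f m = \<one>\<^bsub>wreathZ A\<^esub>"
  using f group.l_inv[OF A] by simp

lemma wreathZ_inv_carrier:
  assumes A: "group A" and "Wr f m \<in> carrier (wreathZ A)"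
  shows "Wr (\<lambda>k. inv\<^bsub>A\<^esub> f (k + m)) (- m) \<in> carrier (wreathZ A)"
  using assms finite_shift[of "\<lambda>k. f k \<noteq> \<one>\<^bsub>A\<^esub>" "- m"]
  by (auto simp: group.inv_closed group.inv_eq_1_iff)

lemma group_wreathZ:
  assumes A: "group A" shows "group (wreathZ A)"
proof (rule groupI)
  interpret A: group A by (rule A)
  fix x assume x: "x \<in> carrier (wreathZ A)"
  then obtain f m where fm: "x = Wr f m" "\<And>k. f k \<in> carrier A" by auto
  show "\<one>\<^bsub>wreathZ A\<^esub> \<otimes>\<^bsub>wreathZ A\<^esub> x = x" using fm by auto
  show "\<exists>y\<in>carrier (wreathZ A). y \<otimes>\<^bsub>wreathZ A\<^esub> x = \<one>\<^bsub>wreathZ A\<^esub>"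
    using wreathZ_l_inv[OF A, of f m] wreathZ_inv_carrier[OF A, of f m] x fm by blast
  fix y assume "y \<in> carrier (wreathZ A)"
  then obtain g n where gn: "y = Wr g n" "\<And>k. g k \<in> carrier A" "finite {k. g k \<noteq> \<one>\<^bsub>A\<^esub>}" by auto
  have "finite {k. f k \<noteq> \<one>\<^bsub>A\<^esub>}" using x fm by auto
  then have "finite ({k. f k \<noteq> \<one>\<^bsub>A\<^esub>} \<union> {k. g (k - m) \<noteq> \<one>\<^bsub>A\<^esub>})"
    using gn(3) finite_shift[of "\<lambda>k. g k \<noteq> \<one>\<^bsub>A\<^esub>" m] by simp
  moreover have "{k. f k \<otimes>\<^bsub>A\<^esub> g (k - m) \<noteq> \<one>\<^bsub>A\<^esub>} \<subseteq> {k. f k \<noteq> \<one>\<^bsub>A\<^esub>} \<union> {k. g (k - m) \<noteq> \<one>\<^bsub>A\<^esub>}"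
    by auto
  ultimately have "finite {k. f k \<otimes>\<^bsub>A\<^esub> g (k - m) \<noteq> \<one>\<^bsub>A\<^esub>}" by (rule finite_subset[rotated])
  then show "x \<otimes>\<^bsub>wreathZ A\<^esub> y \<in> carrier (wreathZ A)" using fm gn by auto
  fix z assume "z \<in> carrier (wreathZ A)"
  then show "x \<otimes>\<^bsub>wreathZ A\<^esub> y \<otimes>\<^bsub>wreathZ A\<^esub> z = x \<otimes>\<^bsub>wreathZ A\<^esub> (y \<otimes>\<^bsub>wreathZ A\<^esub> z)"
    using fm gn by (auto simp: A.m_assoc diff_diff_eq add.assoc)
next
  interpret A: group A by (rule A)
  show "\<one>\<^bsub>wreathZ A\<^esub> \<in> carrier (wreathZ A)" by simp
qed

lemma group_Wgrp: "group (Wgrp n)"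
proof (induction n)
  case 0
  show ?case by (rule groupI) auto
qed (simp add: group_wreathZ)

lemma wreathZ_inv:
  assumes A: "group A" and "Wr f m \<in> carrier (wreathZ A)"
  shows "inv\<^bsub>wreathZ A\<^esub> (Wr f m) = Wr (\<lambda>k. inv\<^bsub>A\<^esub> f (k + m)) (- m)"
  by (rule group.inv_equality[OF group_wreathZ[OF A] wreathZ_l_inv[OF A] assms(2)
      wreathZ_inv_carrier[OF assms]]) (use assms in auto)

lemma PLo_pow_fix:
  assumes "h \<in> PLo_set" "h x = x" shows "(h [^]\<^bsub>PLo\<^esub> (k::int)) x = x"
proof -
  have "subgroup {f \<in> PLo_set. f x = x} PLo"
  proof (rule PLo.subgroupI)
    show "{f \<in> PLo_set. f x = x} \<noteq> {}" using id_PLo by auto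
    show "inv\<^bsub>PLo\<^esub> a \<in> {f \<in> PLo_set. f x = x}" if "a \<in> {f \<in> PLo_set. f x = x}" for a
      using that PLo.inv_closed[of a] PLo_inv_fix by simp
  qed (auto intro: PLo_comp)
  from PLo.subgroup_int_pow_closed[OF this, of h k] assms show ?thesis by simp
qed

text \<open>The conjugates of the copy of \<open>A\<close> by powers of \<open>h\<close> live on the
  disjoint translates of \<open>S\<close> and form the base group; \<open>h\<close> itself is the
  generator of the integers. Nonemptiness of \<open>S\<close> makes the powers of \<open>h\<close>
  distinguishable even when \<open>A\<close> is trivial. A point outside \<open>S\<close> that
  \<open>h\<close> fixes lies in no translate, whence the bound on the support.\<close>

lemma wreathZ_embeds:
  assumes G: "subgroup G PLo" and A: "group A" and emb: "embeds_on A G S \<phi>" and h: "h \<in> G"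
    and disp: "\<And>(k::int) x. k \<noteq> 0 \<Longrightarrow> x \<in> S \<Longrightarrow> (h [^]\<^bsub>PLo\<^esub> k) x \<notin> S" and ne: "S \<noteq> {}"
  shows "\<exists>\<psi>. embeds_on (wreathZ A) G (S \<union> {x. h x \<noteq> x}) \<psi>"
proof -
  interpret A: group A by (rule A)
  have [simp]: "h \<in> PLo_set" using h subgroup.subset[OF G] by auto
  have hG: "h [^]\<^bsub>PLo\<^esub> k \<in> G" for k :: int by (rule PLo.subgroup_int_pow_closed[OF G h])
  have inv: "inv\<^bsub>PLo\<^esub> (h [^]\<^bsub>PLo\<^esub> k) = h [^]\<^bsub>PLo\<^esub> (- k)" for k :: int
    using PLo.int_pow_neg[of h k] by simp
  define S' where "S' k = {x. (h [^]\<^bsub>PLo\<^esub> (- k)) x \<in> S}" for k :: int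
  define \<phi>' where "\<phi>' k a = h [^]\<^bsub>PLo\<^esub> k \<circ> \<phi> a \<circ> h [^]\<^bsub>PLo\<^esub> (- k)" for k :: int and a
  have emb': "embeds_on A G (S' k) (\<phi>' k)" for k
  proof -
    have "embeds_on A G {x. (inv\<^bsub>PLo\<^esub> (h [^]\<^bsub>PLo\<^esub> k)) x \<in> S}
        (\<lambda>a. h [^]\<^bsub>PLo\<^esub> k \<circ> \<phi> a \<circ> inv\<^bsub>PLo\<^esub> (h [^]\<^bsub>PLo\<^esub> k))"
      using subgroup.m_closed[OF G] hG subgroup.m_inv_closed[OF G]
      by (intro embeds_on_conj[OF emb]) auto
    then show ?thesis by (simp add: S'_def \<phi>'_def[abs_def] inv)
  qed
  have disj: "i = j" if "x \<in> S' i" "x \<in> S' j" for i j x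
  proof (rule ccontr)
    assume "i \<noteq> j"
    then have "(h [^]\<^bsub>PLo\<^esub> (i - j)) ((h [^]\<^bsub>PLo\<^esub> (- i)) x) \<notin> S"
      using that(1) by (intro disp) (auto simp: S'_def)
    then show False using that(2) PLo_pow_add[of h "i - j" "- i" x] by (simp add: S'_def)
  qed
  interpret disjoint_embeddings G UNIV "\<lambda>_. A" \<phi>' S'
    by (rule disjoint_embeddings.intro) (use G A emb' disj in auto)
  \<comment> \<open>Conjugation by the power \<open>m\<close> of \<open>h\<close> moves the factor
    at \<open>k\<close> to \<open>k + m\<close>, which is the shift in the multiplication of
    \<open>wreathZ\<close>.\<close>
  have shift: "(h [^]\<^bsub>PLo\<^esub> m) (glue g x) = glue (\<lambda>k. g (k - m)) ((h [^]\<^bsub>PLo\<^esub> m) x)" for m g x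
  proof (cases "\<exists>k. x \<in> S' k")
    case True
    then obtain k where k: "x \<in> S' k" by blast
    have e: "(h [^]\<^bsub>PLo\<^esub> (- (k + m))) ((h [^]\<^bsub>PLo\<^esub> m) x) = (h [^]\<^bsub>PLo\<^esub> (- k)) x"
      using PLo_pow_add[of h "- (k + m)" m x] by simp
    then have "(h [^]\<^bsub>PLo\<^esub> m) x \<in> S' (k + m)" using k by (simp add: S'_def)
    then have "glue (\<lambda>k. g (k - m)) ((h [^]\<^bsub>PLo\<^esub> m) x) = \<phi>' (k + m) (g k) ((h [^]\<^bsub>PLo\<^esub> m) x)"
      by (simp add: glue_in)
    also have "\<dots> = (h [^]\<^bsub>PLo\<^esub> (m + k)) (\<phi> (g k) ((h [^]\<^bsub>PLo\<^esub> (- k)) x))"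
      using e by (simp add: \<phi>'_def add.commute)
    also have "\<dots> = (h [^]\<^bsub>PLo\<^esub> m) (glue g x)"
      using k by (simp add: PLo_pow_add glue_in \<phi>'_def)
    finally show ?thesis by simp
  next
    case False
    have "(h [^]\<^bsub>PLo\<^esub> m) x \<notin> S' k" for k
      using False PLo_pow_add[of h "- k" m x] by (auto simp: S'_def dest: spec[of _ "k - m"])
    then show ?thesis using False by (simp add: glue_out)
  qed
  define \<psi> where "\<psi> w = glue (wfun w) \<circ> h [^]\<^bsub>PLo\<^esub> (wint w)" for w
  have "embeds_on (wreathZ A) G (S \<union> {x. h x \<noteq> x}) \<psi>"
    unfolding embeds_on_def
  proof (intro conjI ballI allI impI)
    show im: "\<psi> ` carrier (wreathZ A) \<subseteq> G"
      using glue_closed hG subgroup.m_closed[OF G] by (auto simp: \<psi>_def)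
    show "\<psi> \<in> hom (wreathZ A) PLo"
    proof (rule homI)
      show "\<psi> w \<in> carrier PLo" if "w \<in> carrier (wreathZ A)" for w
        using that im subgroup.subset[OF G] by blast
      fix v w assume "v \<in> carrier (wreathZ A)" "w \<in> carrier (wreathZ A)"
      then obtain f m g n where v: "v = Wr f m" "\<And>k. f k \<in> carrier A"
        and w: "w = Wr g n" "\<And>k. g k \<in> carrier A" by auto
      have "glue (\<lambda>k. f k \<otimes>\<^bsub>A\<^esub> g (k - m)) = glue f \<circ> glue (\<lambda>k. g (k - m))"
        using v w by (intro glue_mult) auto
      then show "\<psi> (v \<otimes>\<^bsub>wreathZ A\<^esub> w) = \<psi> v \<otimes>\<^bsub>PLo\<^esub> \<psi> w"
        using v w by (auto simp: \<psi>_def fun_eq_iff PLo_pow_add shift)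
    qed
    show "inj_on \<psi> (carrier (wreathZ A))"
    proof (rule inj_onI)
      fix v w assume "v \<in> carrier (wreathZ A)" "w \<in> carrier (wreathZ A)" and eq: "\<psi> v = \<psi> w"
      then obtain f m g n where v: "v = Wr f m" "\<And>k. f k \<in> carrier A"
        and w: "w = Wr g n" "\<And>k. g k \<in> carrier A" by auto
      obtain x where x: "x \<in> S" using ne by blast
      \<comment> \<open>Chosen so that \<open>v\<close> sends \<open>y\<close> into
        \<open>S' 0\<close> whereas \<open>w\<close> sends it into \<open>S' (n - m)\<close>;
        disjointness of the translates then forces equal integer parts.\<close>
      define y where "y = (h [^]\<^bsub>PLo\<^esub> (- m)) x"
      have "\<psi> v y \<in> S' 0" using v x glue_preserves[of f 0] by (simp add: \<psi>_def y_def S'_def)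
      moreover have "(h [^]\<^bsub>PLo\<^esub> n) y \<in> S' (n - m)"
        using x PLo_pow_add[of h "m - n" n y] by (simp add: S'_def y_def)
      then have "\<psi> w y \<in> S' (n - m)" using w glue_preserves[of g] by (simp add: \<psi>_def)
      ultimately have mn: "n = m" using disj[of 0 "n - m" "\<psi> w y"] eq by simp
      have "glue f x = glue g x" for x
        using fun_cong[OF eq, of "(h [^]\<^bsub>PLo\<^esub> (- m)) x"] v w mn by (simp add: \<psi>_def)
      then have "glue f = glue g" by blast
      then have "f k = g k" for k using glue_eqD[of f g k] v w by simp
      then show "v = w" using v w mn by auto
    qed
    show "\<psi> w x = x" if "w \<in> carrier (wreathZ A)" and x: "x \<notin> S \<union> {x. h x \<noteq> x}" for w x
    proof -
      have "x \<notin> S' k" for k using x PLo_pow_fix[of h x "- k"] by (simp add: S'_def)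
      then show ?thesis using x PLo_pow_fix[of h x] by (simp add: \<psi>_def glue_out)
    qed
  qed
  then show ?thesis by blast
qed

section \<open>Iterated wreath products and their direct sum inside non-solvable groups\<close>

text \<open>The induction hypothesis is applied to the derived subgroup, so that \<open>X\<close>
  meets the hypotheses of \<open>displacing_element\<close>. Adding the displacing element to
  \<open>X\<close> covers the support of the new wreath product and keeps \<open>X\<close>
  finite.\<close>

lemma Wgrp_embeds:
  assumes "subgroup G PLo" "\<not> solvable_seq PLo G"
  shows "\<exists>X \<phi>. finite X \<and> X \<subseteq> G \<and> moved X \<noteq> {} \<and> embeds_on (Wgrp n) G (moved X) \<phi>"
  using assms
proof (induction n arbitrary: G)
  case 0
  \<comment> \<open>The group \<open>Wgrp 0\<close> is trivial, but its support set must be nonempty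
    for the next wreath product; any element other than the identity provides one.\<close>
  have "G \<noteq> {id}" using 0(2) solvable_seq.unity[of PLo] by auto
  moreover have one: "id \<in> G" using subgroup.one_closed[OF 0(1)] by simp
  ultimately obtain g where g: "g \<in> G" "g \<noteq> id" by blast
  then have "moved {g} \<noteq> {}" by (auto simp: moved_def fun_eq_iff)
  moreover have "embeds_on (Wgrp 0) G (moved {g}) (\<lambda>_. id)"
    using one id_PLo by (auto simp: embeds_on_def hom_def)
  moreover have "finite {g}" "{g} \<subseteq> G" using g by auto
  ultimately show ?case by blast
next
  case (Suc n)
  let ?D = "derived PLo G"
  have D: "subgroup ?D PLo" using PLo.derived_is_subgroup subgroup.subset[OF Suc.prems(1)] .
  have "\<not> solvable_seq PLo ?D" using Suc.prems PLo.augment_solvable_seq by blast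
  then obtain X \<phi> where X: "finite X" "X \<subseteq> ?D" "moved X \<noteq> {}" and emb: "embeds_on (Wgrp n) ?D (moved X) \<phi>"
    using Suc.IH[OF D] by blast
  have DG: "?D \<subseteq> G" using PLo.derived_incl Suc.prems(1) by blast
  obtain h where h: "h \<in> G" "\<And>k::int. k \<noteq> 0 \<Longrightarrow> \<forall>x\<in>moved X. (h [^]\<^bsub>PLo\<^esub> k) x \<notin> moved X"
    using displacing_element[OF Suc.prems(1) X(1,2)] by blast
  have "\<exists>\<psi>. embeds_on (wreathZ (Wgrp n)) G (moved X \<union> {x. h x \<noteq> x}) \<psi>"
    using h X(3) by (intro wreathZ_embeds[OF Suc.prems(1) group_Wgrp embeds_on_mono[OF emb DG]]) auto
  moreover have "moved X \<union> {x. h x \<noteq> x} = moved (insert h X)" by (auto simp: moved_def)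
  ultimately obtain \<psi> where "embeds_on (Wgrp (Suc n)) G (moved (insert h X)) \<psi>" by auto
  then show ?case using X DG h(1) by (intro exI[of _ "insert h X"] exI[of _ \<psi>]) (auto simp: moved_def)
qed

text \<open>An element that displaces the joint support of \<open>X\<close> and \<open>Y\<close>
  moves the support of \<open>X\<close> off that of \<open>Y\<close>. The derived subgroup is
  normal, so the conjugated copy stays in it and can be absorbed into \<open>Y\<close> in the next
  round.\<close>

lemma Wgrp_embeds_disjointly:
  assumes G: "subgroup G PLo" and ns: "\<not> solvable_seq PLo G" and Y: "finite Y" "Y \<subseteq> derived PLo G"
  shows "\<exists>X \<phi>. finite X \<and> X \<subseteq> derived PLo G \<and> moved X \<inter> moved Y = {} \<and>
    embeds_on (Wgrp n) (derived PLo G) (moved X) \<phi>"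
proof -
  let ?D = "derived PLo G"
  have D: "subgroup ?D PLo" using PLo.derived_is_subgroup subgroup.subset[OF G] .
  have "\<not> solvable_seq PLo ?D" using ns PLo.augment_solvable_seq[OF G] by blast
  then obtain X \<phi> where X: "finite X" "X \<subseteq> ?D" and emb: "embeds_on (Wgrp n) ?D (moved X) \<phi>"
    using Wgrp_embeds[OF D] by blast
  obtain h where h: "h \<in> G"
    and disp: "\<And>k::int. k \<noteq> 0 \<Longrightarrow> \<forall>x\<in>moved (X \<union> Y). (h [^]\<^bsub>PLo\<^esub> k) x \<notin> moved (X \<union> Y)"
    using displacing_element[OF G, of "X \<union> Y"] X Y by auto
  have hP: "h \<in> PLo_set" using h subgroup.subset[OF G] by auto
  have norm: "h \<circ> f \<circ> inv\<^bsub>PLo\<^esub> h \<in> ?D" if f: "f \<in> ?D" for f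
    using normal.inv_op_closed2[OF PLo.derived_subgroup_is_normal[OF G], of h f] h f
      PLo.m_inv_consistent[OF G h] by simp
  let ?X = "(\<lambda>f. h \<circ> f \<circ> inv\<^bsub>PLo\<^esub> h) ` X"
  have movX: "moved ?X = {x. (inv\<^bsub>PLo\<^esub> h) x \<in> moved X}"
  proof -
    have "h (f ((inv\<^bsub>PLo\<^esub> h) x)) = x \<longleftrightarrow> f ((inv\<^bsub>PLo\<^esub> h) x) = (inv\<^bsub>PLo\<^esub> h) x" for f x
      using PLo_inv_apply[OF hP] by metis
    then show ?thesis by (auto simp: moved_def)
  qed
  have "moved ?X \<inter> moved Y = {}"
  proof -
    have False if x: "(inv\<^bsub>PLo\<^esub> h) x \<in> moved X" "x \<in> moved Y" for x
    proof -
      have "(inv\<^bsub>PLo\<^esub> h) x \<in> moved (X \<union> Y)" "x \<in> moved (X \<union> Y)" using x by (auto simp: moved_def)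
      then show False using disp[of 1] hP by (auto simp: PLo_pow_one)
    qed
    then show ?thesis by (auto simp: movX)
  qed
  moreover have "embeds_on (Wgrp n) ?D (moved ?X) (\<lambda>a. h \<circ> \<phi> a \<circ> inv\<^bsub>PLo\<^esub> h)"
    unfolding movX using norm by (intro embeds_on_conj[OF emb hP]) auto
  ultimately show ?thesis using X norm
    by (intro exI[of _ ?X] exI[of _ "\<lambda>a. h \<circ> \<phi> a \<circ> inv\<^bsub>PLo\<^esub> h"]) auto
qed

lemma Wsum_embeds:
  assumes G: "subgroup G PLo" and ns: "\<not> solvable_seq PLo G"
  shows "\<exists>K. K \<subseteq> G \<and> subgroup K PLo \<and> PLo\<lparr>carrier := K\<rparr> \<cong> Wsum"
proof -
  let ?D = "derived PLo G"
  have D: "subgroup ?D PLo" using PLo.derived_is_subgroup subgroup.subset[OF G] .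
  define Q where "Q n Y p \<longleftrightarrow> finite (fst p) \<and> fst p \<subseteq> ?D \<and> moved (fst p) \<inter> moved Y = {} \<and>
      embeds_on (Wgrp n) ?D (moved (fst p)) (snd p)" for n Y p
  define c where "c n Y = (SOME p. Q n Y p)" for n Y
  have c: "Q n Y (c n Y)" if "finite Y" "Y \<subseteq> ?D" for n Y
    unfolding c_def
    by (rule someI_ex) (use Wgrp_embeds_disjointly[OF G ns that, of n] in \<open>auto simp: Q_def\<close>)
  \<comment> \<open>\<open>Y n\<close> unites the sets \<open>X m\<close> for m < n, so avoiding the
    single finite set \<open>Y n\<close> separates the new copy from all earlier ones.\<close>
  define Y where "Y = rec_nat {} (\<lambda>n Z. Z \<union> fst (c n Z))"
  define X where "X n = fst (c n (Y n))" for n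
  define \<phi> where "\<phi> n = snd (c n (Y n))" for n
  have Y_Suc: "Y (Suc n) = Y n \<union> X n" for n by (simp add: Y_def X_def)
  have Y: "finite (Y n) \<and> Y n \<subseteq> ?D" for n
  proof (induction n)
    case 0 show ?case by (simp add: Y_def)
  next
    case (Suc n) then show ?case using c[of "Y n" n] by (simp add: Y_Suc X_def Q_def)
  qed
  have X: "moved (X n) \<inter> moved (Y n) = {}" "embeds_on (Wgrp n) ?D (moved (X n)) (\<phi> n)" for n
    using c[of "Y n" n] Y[of n] by (auto simp: X_def \<phi>_def Q_def)
  have XY: "X m \<subseteq> Y n" if "m < n" for m n
    using that by (induction n) (auto simp: Y_Suc less_Suc_eq)
  have disj: "\<not> m < n" if "x \<in> moved (X m)" "x \<in> moved (X n)" for m n x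
  proof
    assume "m < n"
    then have "x \<in> moved (Y n)" using XY that(1) unfolding moved_def by blast
    then show False using X(1) that(2) by blast
  qed
  interpret disjoint_embeddings ?D "{i. 1 \<le> i}" Wgrp \<phi> "\<lambda>i. moved (X i)"
  proof (rule disjoint_embeddings.intro)
    show "i = j" if "x \<in> moved (X i)" "x \<in> moved (X j)" for i j x
      using disj[OF that] disj[OF that(2,1)] by simp
  qed (use D group_Wgrp X(2) in auto)
  have carrier: "x \<in> carrier Wsum \<longleftrightarrow> x \<in> (\<Pi>\<^sub>E i\<in>{i. 1 \<le> i}. carrier (Wgrp i)) \<and>
      finite {i \<in> {i. 1 \<le> i}. x i \<noteq> \<one>\<^bsub>Wgrp i\<^esub>}" for x
    unfolding Wsum_def by (subst carrier_sum_group) (simp_all add: group_Wgrp)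
  have closed: "glue x \<in> ?D" if "x \<in> carrier Wsum" for x
    using that carrier by (intro glue_closed) (auto simp: PiE_iff)
  have hom: "glue \<in> hom Wsum PLo"
  proof (rule homI)
    show "glue x \<in> carrier PLo" if "x \<in> carrier Wsum" for x
      using closed[OF that] subgroup.subset[OF D] by blast
    fix x y assume "x \<in> carrier Wsum" "y \<in> carrier Wsum"
    then have xy: "x i \<in> carrier (Wgrp i)" "y i \<in> carrier (Wgrp i)" if "1 \<le> i" for i
      using that carrier by (auto simp: PiE_iff)
    have "glue (x \<otimes>\<^bsub>Wsum\<^esub> y) = glue (\<lambda>i. x i \<otimes>\<^bsub>Wgrp i\<^esub> y i)"
      by (rule glue_cong) (simp add: Wsum_def)
    also have "\<dots> = glue x \<circ> glue y" using xy by (intro glue_mult) auto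
    finally show "glue (x \<otimes>\<^bsub>Wsum\<^esub> y) = glue x \<otimes>\<^bsub>PLo\<^esub> glue y" by simp
  qed
  have inj: "inj_on glue (carrier Wsum)"
  proof (rule inj_onI)
    fix x y assume xy: "x \<in> carrier Wsum" "y \<in> carrier Wsum" and eq: "glue x = glue y"
    then have "x i = y i" if "i \<in> {i. 1 \<le> i}" for i
      using that carrier by (intro glue_eqD[OF eq]) (auto simp: PiE_iff)
    then show "x = y" using xy carrier by (meson PiE_ext)
  qed
  have gW: "group Wsum" unfolding Wsum_def by (simp add: group_Wgrp)
  define K where "K = glue ` carrier Wsum"
  have "group_hom Wsum PLo glue"
    unfolding group_hom_def group_hom_axioms_def using gW group_PLo hom by blast
  then have "subgroup K PLo"
    unfolding K_def by (rule group_hom.img_is_subgroup)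
  moreover have "K \<subseteq> G" using closed PLo.derived_incl[OF order_refl G] unfolding K_def by blast
  moreover have "glue \<in> iso Wsum (PLo\<lparr>carrier := K\<rparr>)"
    using hom inj by (auto simp: iso_def hom_def bij_betw_def K_def)
  then have "PLo\<lparr>carrier := K\<rparr> \<cong> Wsum" by (metis group.iso_sym gW is_isoI)
  ultimately show ?thesis by blast
qed

section \<open>Derived series of the iterated wreath products\<close>

lemma (in group) exp_of_derived_consistent:
  assumes "K \<subseteq> H" "subgroup H G"
  shows "(derived (G\<lparr>carrier := H\<rparr>) ^^ n) K = (derived G ^^ n) K \<and> (derived G ^^ n) K \<subseteq> H"
proof (induction n)
  case (Suc n)
  then show ?case using derived_consistent[OF _ assms(2)] derived_incl[OF _ assms(2)] by simp
qed (simp add: assms)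

text \<open>The derived subgroup of the wreath product lies in the base group, and the commutators with the generator
  of the integers project onto every element of the factor with index 0.\<close>

lemma wreathZ_derived_trivial:
  assumes A: "group A" and triv: "(derived (wreathZ A) ^^ Suc n) (carrier (wreathZ A)) = {\<one>\<^bsub>wreathZ A\<^esub>}"
  shows "(derived A ^^ n) (carrier A) = {\<one>\<^bsub>A\<^esub>}"
proof -
  define M where "M = wreathZ A"
  interpret A: group A by (rule A)
  interpret M: group M unfolding M_def by (rule group_wreathZ[OF A])
  \<comment> \<open>The base group; evaluation at 0 is multiplicative on it because its elements
    shift nothing.\<close>
  define B where "B = {w \<in> carrier M. wint w = 0}"
  define D where "D = derived M (carrier M)"
  have wint_mult: "wint (v \<otimes>\<^bsub>M\<^esub> w) = wint v + wint w" for v w by (simp add: M_def wreathZ_def)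
  have wint_inv: "wint (inv\<^bsub>M\<^esub> w) = - wint w" if "w \<in> carrier M" for w
    using wint_mult[of "inv\<^bsub>M\<^esub> w" w] M.l_inv[OF that] by (simp add: M_def)
  have B: "subgroup B M"
  proof (rule M.subgroupI)
    have "\<one>\<^bsub>M\<^esub> \<in> B" using M.one_closed by (simp add: B_def M_def)
    then show "B \<noteq> {}" by blast
  qed (auto simp: B_def wint_mult wint_inv)
  have "derived_set M (carrier M) \<subseteq> B" by (auto simp: B_def wint_mult wint_inv)
  then have DB: "D \<subseteq> B" unfolding D_def derived_def using B by (rule M.generate_subgroup_incl)
  let ?p = "\<lambda>w. wfun w 0"
  have "?p \<in> hom (M\<lparr>carrier := B\<rparr>) A"
  proof (rule homI)
    show "?p w \<in> carrier A" if "w \<in> carrier (M\<lparr>carrier := B\<rparr>)" for w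
      using that by (auto simp: B_def M_def)
    show "?p (v \<otimes>\<^bsub>M\<lparr>carrier := B\<rparr>\<^esub> w) = ?p v \<otimes>\<^bsub>A\<^esub> ?p w"
      if "v \<in> carrier (M\<lparr>carrier := B\<rparr>)" for v w
      using that by (auto simp: B_def M_def wreathZ_def)
  qed
  then have hom: "group_hom (M\<lparr>carrier := B\<rparr>) A ?p"
    using M.subgroup_imp_group[OF B] A by (simp add: group_hom_def group_hom_axioms_def)
  have "carrier A \<subseteq> ?p ` D"
  proof
    fix a assume a: "a \<in> carrier A"
    define f where "f k = (if k = (0::int) then a else \<one>\<^bsub>A\<^esub>)" for k
    let ?f = "Wr f 0" and ?t = "Wr (\<lambda>_. \<one>\<^bsub>A\<^esub>) 1"
    have "{k. f k \<noteq> \<one>\<^bsub>A\<^esub>} \<subseteq> {0}" by (auto simp: f_def)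
    then have f: "?f \<in> carrier (wreathZ A)" using a finite_subset by (auto simp: f_def)
    have t: "?t \<in> carrier (wreathZ A)" by simp
    \<comment> \<open>This commutator has \<open>a\<close> at 0, the inverse of \<open>a\<close> at
      1 and the identity elsewhere.\<close>
    have "?f \<otimes>\<^bsub>M\<^esub> ?t \<otimes>\<^bsub>M\<^esub> inv\<^bsub>M\<^esub> ?f \<otimes>\<^bsub>M\<^esub> inv\<^bsub>M\<^esub> ?t \<in> derived_set M (carrier M)"
      using f t unfolding M_def by blast
    then have "?f \<otimes>\<^bsub>M\<^esub> ?t \<otimes>\<^bsub>M\<^esub> inv\<^bsub>M\<^esub> ?f \<otimes>\<^bsub>M\<^esub> inv\<^bsub>M\<^esub> ?t \<in> D"
      unfolding D_def derived_def by (rule generate.incl)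
    moreover have "?p (?f \<otimes>\<^bsub>M\<^esub> ?t \<otimes>\<^bsub>M\<^esub> inv\<^bsub>M\<^esub> ?f \<otimes>\<^bsub>M\<^esub> inv\<^bsub>M\<^esub> ?t) = a"
      using a by (simp add: M_def wreathZ_inv[OF A f] wreathZ_inv[OF A t] f_def)
    ultimately show "a \<in> ?p ` D" by force
  qed
  then have "(derived A ^^ n) (carrier A) \<subseteq> (derived A ^^ n) (?p ` D)"
    by (rule A.mono_exp_of_derived)
  also have "\<dots> = ?p ` ((derived (M\<lparr>carrier := B\<rparr>) ^^ n) D)"
    using DB by (intro group_hom.exp_of_derived_img[OF hom]) simp
  also have "(derived (M\<lparr>carrier := B\<rparr>) ^^ n) D = (derived M ^^ n) D"
    using M.exp_of_derived_consistent[OF DB B] by blast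
  also have "\<dots> = {\<one>\<^bsub>M\<^esub>}" using triv by (simp add: D_def M_def funpow_swap1)
  also have "?p ` {\<one>\<^bsub>M\<^esub>} = {\<one>\<^bsub>A\<^esub>}" by (simp add: M_def)
  finally show ?thesis
    using subgroup.one_closed[OF A.exp_of_derived_is_subgroup[OF A.subgroup_self, of n]] by blast
qed

text \<open>Each wreath product raises the derived length by at least one. The count starts at
  \<open>Wgrp 1\<close>, the integers, because \<open>Wgrp 0\<close> is trivial; hence the offset
  between index and exponent.\<close>

lemma Wgrp_derived_nontrivial:
  "(derived (Wgrp (Suc n)) ^^ n) (carrier (Wgrp (Suc n))) \<noteq> {\<one>\<^bsub>Wgrp (Suc n)\<^esub>}"
proof (induction n)
  case 0
  have "Wr (\<lambda>_. Triv) 1 \<in> carrier (Wgrp (Suc 0))" by simp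
  moreover have "Wr (\<lambda>_. Triv) 1 \<noteq> \<one>\<^bsub>Wgrp (Suc 0)\<^esub>" by simp
  ultimately show ?case by (metis funpow_0 singletonD)
next
  case (Suc n)
  then show ?case
    using wreathZ_derived_trivial[OF group_Wgrp[of "Suc n"], of n] Wgrp.simps(2)[of "Suc n"] by argo
qed

text \<open>If the derived series of the sum ended after n steps, so would that of its quotient
  \<open>Wgrp (Suc n)\<close>.\<close>

lemma Wsum_not_solvable: "\<not> solvable Wsum"
proof
  assume "solvable Wsum"
  interpret W: group Wsum unfolding Wsum_def by (simp add: group_Wgrp)
  have carrier: "carrier Wsum = {x \<in> (\<Pi>\<^sub>E i\<in>{i. 1 \<le> i}. carrier (Wgrp i)).
      finite {i \<in> {i. 1 \<le> i}. x i \<noteq> \<one>\<^bsub>Wgrp i\<^esub>}}"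
    unfolding Wsum_def by (rule carrier_sum_group) (rule group_Wgrp)
  obtain n where n: "(derived Wsum ^^ n) (carrier Wsum) = {\<one>\<^bsub>Wsum\<^esub>}"
    using \<open>solvable Wsum\<close> W.solvable_iff_trivial_derived_seq by blast
  let ?A = "Wgrp (Suc n)" and ?p = "\<lambda>x. x (Suc n)"
  have "?p \<in> hom Wsum ?A"
  proof (rule homI)
    show "?p x \<in> carrier ?A" if "x \<in> carrier Wsum" for x
      using that PiE_mem[of x "{i. 1 \<le> i}" "\<lambda>i. carrier (Wgrp i)" "Suc n"] unfolding carrier by simp
    show "?p (x \<otimes>\<^bsub>Wsum\<^esub> y) = ?p x \<otimes>\<^bsub>?A\<^esub> ?p y" for x y by (simp add: Wsum_def)
  qed
  then have hom: "group_hom Wsum ?A ?p"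
    unfolding group_hom_def group_hom_axioms_def using group_Wgrp W.is_group by blast
  have "carrier ?A \<subseteq> ?p ` carrier Wsum"
  proof
    fix a assume a: "a \<in> carrier ?A"
    define x where "x = (\<lambda>i\<in>{i. 1 \<le> i}. if i = Suc n then a else \<one>\<^bsub>Wgrp i\<^esub>)"
    have "{i \<in> {i. 1 \<le> i}. x i \<noteq> \<one>\<^bsub>Wgrp i\<^esub>} \<subseteq> {Suc n}" by (auto simp: x_def)
    then have "finite {i \<in> {i. 1 \<le> i}. x i \<noteq> \<one>\<^bsub>Wgrp i\<^esub>}" by (rule finite_subset) simp
    moreover have "x \<in> (\<Pi>\<^sub>E i\<in>{i. 1 \<le> i}. carrier (Wgrp i))"
      unfolding x_def using a group_Wgrp[THEN group.is_monoid, THEN monoid.one_closed] by simp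
    ultimately have "x \<in> carrier Wsum" unfolding carrier by blast
    moreover have "?p x = a" by (simp add: x_def)
    ultimately show "a \<in> ?p ` carrier Wsum" by blast
  qed
  then have "?p ` carrier Wsum = carrier ?A" using group_hom.hom_closed[OF hom] by blast
  then have "(derived ?A ^^ n) (carrier ?A) = ?p ` {\<one>\<^bsub>Wsum\<^esub>}"
    using group_hom.exp_of_derived_img[OF hom order_refl, of n] n by (simp only:)
  also have "\<dots> = {\<one>\<^bsub>?A\<^esub>}" by (simp only: image_insert image_empty group_hom.hom_one[OF hom])
  finally show False using Wgrp_derived_nontrivial by blast
qed

text \<open>The embedding argument speaks of \<open>solvable_seq\<close> in the ambient group, the
  theorem of \<open>solvable\<close> for the restricted carrier. Both say that the derived series
  reaches the trivial group, and this series is the same in either group.\<close>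

lemma (in group) solvable_seq_subgroup_iff:
  assumes H: "subgroup H G"
  shows "solvable_seq G H \<longleftrightarrow> solvable (G\<lparr>carrier := H\<rparr>)"
proof -
  interpret H: group "G\<lparr>carrier := H\<rparr>" by (rule subgroup_imp_group[OF H])
  have "solvable_seq G H \<longleftrightarrow> (\<exists>n. (derived G ^^ n) H = {\<one>})"
    using trivial_derived_seq_imp_solvable[OF H] solvable_imp_trivial_derived_seq by blast
  then show ?thesis
    using H.solvable_iff_trivial_derived_seq exp_of_derived_consistent[OF order_refl H] by simp
qed

theorem theorem2:
  assumes "subgroup H PLo"
  shows "\<not> solvable (PLo\<lparr>carrier := H\<rparr>) \<longleftrightarrow>
         (\<exists>K. K \<subseteq> H \<and> subgroup K PLo \<and> PLo\<lparr>carrier := K\<rparr> \<cong> Wsum)"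
proof
  assume "\<not> solvable (PLo\<lparr>carrier := H\<rparr>)"
  then show "\<exists>K. K \<subseteq> H \<and> subgroup K PLo \<and> PLo\<lparr>carrier := K\<rparr> \<cong> Wsum"
    using Wsum_embeds[OF assms] PLo.solvable_seq_subgroup_iff[OF assms] by blast
next
  assume "\<exists>K. K \<subseteq> H \<and> subgroup K PLo \<and> PLo\<lparr>carrier := K\<rparr> \<cong> Wsum"
  then obtain K f where K: "K \<subseteq> H" "subgroup K PLo" and f: "f \<in> iso (PLo\<lparr>carrier := K\<rparr>) Wsum"
    unfolding is_iso_def by blast
  have gK: "group (PLo\<lparr>carrier := K\<rparr>)" by (rule PLo.subgroup_imp_group[OF K(2)])
  have gW: "group Wsum" unfolding Wsum_def by (simp add: group_Wgrp)
  show "\<not> solvable (PLo\<lparr>carrier := H\<rparr>)"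
  proof
    assume "solvable (PLo\<lparr>carrier := H\<rparr>)"
    moreover have "group_hom (PLo\<lparr>carrier := K\<rparr>) (PLo\<lparr>carrier := H\<rparr>) (\<lambda>g. g)"
      using gK PLo.subgroup_imp_group[OF assms] K(1)
      by (auto simp: group_hom_def group_hom_axioms_def hom_def)
    ultimately have "solvable (PLo\<lparr>carrier := K\<rparr>)"
      using group_hom.inj_hom_imp_solvable by fastforce
    moreover have "group_hom (PLo\<lparr>carrier := K\<rparr>) Wsum f"
      using gK gW f by (simp add: group_hom_def group_hom_axioms_def iso_def)
    moreover have "f ` carrier (PLo\<lparr>carrier := K\<rparr>) = carrier Wsum"
      using f by (simp add: iso_def bij_betw_def)
    ultimately have "solvable Wsum" by (metis group_hom.surj_hom_imp_solvable)
    then show False using Wsum_not_solvable by blast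
  qed
qed

end
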